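(* Let $X=V(f)\subseteq\mathbb{P}^3$ be a surface of degree $d\geq4$ over $\mathbb{C}$ with at most isolated singularities. Assume that $\tau(X)<(d-2)(d-1)^2$ and that there exists a plane $H'$ with $H'\cap\operatorname{Sing}(X)=\emptyset$ such that $W=X\cap H'$ has exactly three noncollinear nodes. Then the hyperplane-section map $$\Phi(f):\mathbb{P}^{3*}\dashrightarrow\mathcal{M}(d,2)$$ is generically finite onto its image.
   Context: $f\in\mathbb{C}[x_0,\ldots,x_3]$ is a homogeneous polynomial of degree $d$ defining $X$. "$W$ has exactly three noncollinear nodes" means that the singular locus of the plane curve $W\subseteq H'\simeq\mathbb{P}^2$ consists of exactly three points, each a node, not lying on a line. Tjurina number: for $p\in\operatorname{Sing}(X)$, with local coordinates $y_1,y_2,y_3$ at $p$ and a local equation $h$ of $X$ at $p$, $\tau(X,p)=\dim_{\mathbb{C}}\mathcal{O}_{\mathbb{P}^3,p}/(h,\partial h/\partial y_1,\partial h/\partial y_2,\partial h/\partial y_3)$, and $\tau(X)=\sum_{p\in\operatorname{Sing}(X)}\tau(X,p)$. $\mathcal{M}(d,2)$ is the coarse moduli space of smooth degree $d$ curves in $\mathbb{P}^2$, i.e. the geometric (GIT) quotient by $PGL_3(\mathbb{C})$ of the open subset of $\mathbb{P}(\mathbb{C}[x_1,x_2,x_3]_d)$ parametrizing smooth curves. $U_f=\{H\in\mathbb{P}^{3*}\mid X\cap H\text{ is smooth}\}$ is nonempty and Zariski open, and $\Phi(f)$ is the rational map given on $U_f$ by $H\mapsto[X\cap H]$, where $X\cap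 H\subseteq H\simeq\mathbb{P}^2$. It is generically finite onto its image if the general fiber of $\mathbb{P}^{3*}\dashrightarrow\operatorname{Im}\Phi(f)$ is finite, equivalently $\dim\operatorname{Im}\Phi(f)=3$. *)

theory Defs
  imports
    "HOL-Analysis.Analysis"
    "HOL-Library.Poly_Mapping"
    "HOL-Library.Extended_Nat"
    "HOL-Computational_Algebra.Fraction_Field"
    "HOL-Algebra.QuotRing"
    "HOL-Algebra.Embedded_Algebras"
begin

text \<open>
  Polynomials with variables indexed by \<^typ>\<open>'v\<close>: finitely supported functions from
  exponent vectors to coefficients.  The ring structure, and for linearly ordered \<^typ>\<open>'v\<close>
  the integral domain structure, are those of the library.  The coordinates on affine
  \<open>n\<close>-space are indexed by the numeral type \<open>n\<close>.
\<close>

type_synonym 'v monom = "'v \<Rightarrow>\<^sub>0 nat"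
type_synonym 'v mpoly = "'v monom \<Rightarrow>\<^sub>0 complex"

definition Const :: "complex \<Rightarrow> 'v mpoly" where
  "Const c = Poly_Mapping.single 0 c"

definition Var :: "'v \<Rightarrow> 'v mpoly" where
  "Var i = Poly_Mapping.single (Poly_Mapping.single i 1) 1"

definition mdeg :: "'v monom \<Rightarrow> nat" where
  "mdeg m = (\<Sum>i\<in>Poly_Mapping.keys m. Poly_Mapping.lookup m i)"

definition homogeneous :: "nat \<Rightarrow> 'v mpoly \<Rightarrow> bool" where
  "homogeneous d f \<longleftrightarrow> (\<forall>m\<in>Poly_Mapping.keys f. mdeg m = d)"

text \<open>Evaluation at \<open>x\<close> in a commutative ring, with \<open>\<kappa>\<close> interpreting the coefficients.\<close>

definition mp_eval :: "(complex \<Rightarrow> 'r::comm_ring_1) \<Rightarrow> ('v \<Rightarrow> 'r) \<Rightarrow> 'v mpoly \<Rightarrow> 'r" where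
  "mp_eval \<kappa> x f =
     (\<Sum>m\<in>Poly_Mapping.keys f. \<kappa> (Poly_Mapping.lookup f m) *
        (\<Prod>i\<in>Poly_Mapping.keys m. x i ^ Poly_Mapping.lookup m i))"

abbreviation eval :: "('v \<Rightarrow> complex) \<Rightarrow> 'v mpoly \<Rightarrow> complex" where
  "eval \<equiv> mp_eval (\<lambda>c. c)"

abbreviation subst_mp :: "('v \<Rightarrow> 'w mpoly) \<Rightarrow> 'v mpoly \<Rightarrow> 'w mpoly" where
  "subst_mp \<equiv> mp_eval Const"

definition pderiv_mp :: "'v \<Rightarrow> 'v mpoly \<Rightarrow> 'v mpoly" where
  "pderiv_mp i f =
     (\<Sum>m\<in>Poly_Mapping.keys f.
        Poly_Mapping.single (m - Poly_Mapping.single i 1)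
          (of_nat (Poly_Mapping.lookup m i) * Poly_Mapping.lookup f m))"

definition linear_form :: "complex^'m::finite \<Rightarrow> 'm mpoly" where
  "linear_form a = (\<Sum>j\<in>UNIV. Const (a $ j) * Var j)"

text \<open>The composite of \<open>f\<close> with \<open>y \<mapsto> v + M *v y\<close>.\<close>

definition affine_pullback ::
    "complex^'n \<Rightarrow> complex^'m^'n \<Rightarrow> 'n::finite mpoly \<Rightarrow> 'm::finite mpoly" where
  "affine_pullback v M f = subst_mp (\<lambda>i. Const (v $ i) + linear_form (M $ i)) f"

abbreviation linear_pullback :: "complex^'m^'n \<Rightarrow> 'n::finite mpoly \<Rightarrow> 'm::finite mpoly" where
  "linear_pullback \<equiv> affine_pullback 0"

text \<open>A point of projective space is a one-dimensional linear subspace.\<close>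

definition proj_pt :: "complex^'n \<Rightarrow> (complex^'n) set" where
  "proj_pt v = vec.span {v}"

definition proj_space :: "(complex^'n) set set" where
  "proj_space = {proj_pt v | v. v \<noteq> 0}"

text \<open>
  A point \<open>H\<close> of the dual projective space consists of the multiples of a coefficient vector \<open>a\<close>;
  it stands for the hyperplane with equation \<open>\<Sum>i. a\<^sub>i x\<^sub>i = 0\<close>.
\<close>

definition hyperplane_cone :: "(complex^'n) set \<Rightarrow> (complex^'n) set" where
  "hyperplane_cone H = {x. \<forall>a\<in>H. (\<Sum>i\<in>UNIV. a $ i * x $ i) = 0}"

definition hyperplane :: "(complex^'n) set \<Rightarrow> (complex^'n) set set" where
  "hyperplane H = {proj_pt x | x. x \<noteq> 0 \<and> x \<in> hyperplane_cone H}"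

definition collinear_pts :: "(complex^3) set set \<Rightarrow> bool" where
  "collinear_pts S \<longleftrightarrow> (\<exists>L\<in>proj_space. S \<subseteq> hyperplane L)"

definition Sing :: "'n::finite mpoly \<Rightarrow> (complex^'n) set set" where
  "Sing f = {proj_pt v | v. v \<noteq> 0 \<and> eval (($) v) f = 0 \<and>
                            (\<forall>i. eval (($) v) (pderiv_mp i f) = 0)}"

text \<open>
  An affine chart centred at \<open>p\<close>: \<open>v\<close> together with the columns of \<open>M\<close> is a basis of the
  vector space, \<open>v\<close> represents \<open>p\<close>, and \<open>y\<close> are the affine coordinates of the class of
  \<open>v + M *v y\<close>.
\<close>

definition affine_chart :: "(complex^'n) set \<Rightarrow> complex^'n \<Rightarrow> complex^'m^'n \<Rightarrow> bool" where
  "affine_chart p v M \<longleftrightarrow> p = proj_pt v \<and> bij (\<lambda>(s, y). s *s v + M *v y)"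

text \<open>
  The chart is an arbitrary choice; another one changes the local equation by a local coordinate
  change and a unit of the local ring.  The number of local coordinates, the cardinality of
  \<open>'m\<close>, is determined by the result type and must be one less than that of \<open>'n\<close> for charts
  to exist.
\<close>

definition local_equation :: "'n::finite mpoly \<Rightarrow> (complex^'n) set \<Rightarrow> 'm::finite mpoly" where
  "local_equation f p =
     (let (v, M) = (SOME (v, M). affine_chart p v M) in affine_pullback v M f)"

text \<open>
  A node (ordinary double point) of a plane curve: a point of multiplicity two with two distinct
  tangent lines, i.e. the lowest order part of the local equation is the product of two
  non-proportional linear forms.
\<close>

definition node_at_origin :: "2 mpoly \<Rightarrow> bool" where
  "node_at_origin h \<longleftrightarrow>
     (\<forall>m. mdeg m < 2 \<longrightarrow> Poly_Mapping.lookup h m = 0) \<and>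
     (\<exists>a b. a \<noteq> 0 \<and> b \<noteq> 0 \<and> proj_pt a \<noteq> proj_pt b \<and>
        (\<forall>m. mdeg m = 2 \<longrightarrow>
           Poly_Mapping.lookup h m = Poly_Mapping.lookup (linear_form a * linear_form b) m))"

definition is_node :: "3 mpoly \<Rightarrow> (complex^3) set \<Rightarrow> bool" where
  "is_node g p \<longleftrightarrow> node_at_origin (local_equation g p)"

definition three_noncollinear_nodes :: "3 mpoly \<Rightarrow> bool" where
  "three_noncollinear_nodes g \<longleftrightarrow>
     card (Sing g) = 3 \<and> (\<forall>p\<in>Sing g. is_node g p) \<and> \<not> collinear_pts (Sing g)"

text \<open>The local ring of affine space at the origin: fractions whose denominator does not
  vanish there.\<close>

definition local_ring :: "('v::linorder mpoly) fract ring" where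
  "local_ring =
     \<lparr>carrier = {Fract a b | a b. eval (\<lambda>_. 0) b \<noteq> 0},
      monoid.mult = (*), one = 1, ring.zero = 0, add = (+)\<rparr>"

definition tjurina_ideal :: "'v::linorder mpoly \<Rightarrow> 'v mpoly fract set" where
  "tjurina_ideal h = Idl\<^bsub>local_ring\<^esub> ((\<lambda>a. Fract a 1) ` insert h (range (\<lambda>j. pderiv_mp j h)))"

definition tjurina_algebra :: "'v::linorder mpoly \<Rightarrow> 'v mpoly fract set ring" where
  "tjurina_algebra h = local_ring Quot (tjurina_ideal h)"

definition tjurina_scalars :: "'v::linorder mpoly \<Rightarrow> 'v mpoly fract set set" where
  "tjurina_scalars h = range (\<lambda>c. tjurina_ideal h +>\<^bsub>local_ring\<^esub> Fract (Const c) 1)"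

definition tjurina_at_origin :: "'v::linorder mpoly \<Rightarrow> enat" where
  "tjurina_at_origin h =
     (let A = tjurina_algebra h; K = tjurina_scalars h in
      if ring.finite_dimension A K (carrier A) then enat (ring.dim A K (carrier A)) else \<infinity>)"

definition tjurina_at :: "4 mpoly \<Rightarrow> (complex^4) set \<Rightarrow> enat" where
  "tjurina_at f p = tjurina_at_origin (local_equation f p :: 3 mpoly)"

definition tjurina :: "4 mpoly \<Rightarrow> enat" where
  "tjurina f = (\<Sum>p\<in>Sing f. tjurina_at f p)"

definition curve_pt :: "3 mpoly \<Rightarrow> 3 mpoly set" where
  "curve_pt g = range (\<lambda>c. Const c * g)"

definition curve_space :: "nat \<Rightarrow> 3 mpoly set set" where
  "curve_space d = {curve_pt g | g. g \<noteq> 0 \<and> homogeneous d g}"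

text \<open>
  The Zariski topology on the projective space of degree \<open>d\<close> plane curves, generated by the
  complements of hypersurfaces.  A form \<open>F\<close> in the coefficients has variables indexed by the
  monomials of all degrees; variables belonging to degrees other than \<open>d\<close> take the value 0.
\<close>

definition curve_zariski :: "nat \<Rightarrow> 3 mpoly set topology" where
  "curve_zariski d = topology_generated_by
     {{curve_pt g | g. g \<noteq> 0 \<and> homogeneous d g \<and> eval (Poly_Mapping.lookup g) F \<noteq> 0}
       | F k. homogeneous k (F :: 3 monom mpoly)}"

definition smooth_form :: "nat \<Rightarrow> 3 mpoly \<Rightarrow> bool" where
  "smooth_form d g \<longleftrightarrow> g \<noteq> 0 \<and> homogeneous d g \<and> Sing g = {}"

definition smooth_curves :: "nat \<Rightarrow> 3 mpoly set set" where
  "smooth_curves d = {curve_pt g | g. smooth_form d g}"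

definition curve_orbit :: "3 mpoly set \<Rightarrow> 3 mpoly set set" where
  "curve_orbit C = {linear_pullback A ` C | A :: complex^3^3. invertible A}"

definition quotient_topology :: "'a topology \<Rightarrow> ('a \<Rightarrow> 'b) \<Rightarrow> 'b topology" where
  "quotient_topology X q =
     topology (\<lambda>S. S \<subseteq> q ` topspace X \<and> openin X {x \<in> topspace X. q x \<in> S})"

lemma openin_quotient_topology:
  "openin (quotient_topology X q) S \<longleftrightarrow>
     S \<subseteq> q ` topspace X \<and> openin X {x \<in> topspace X. q x \<in> S}"
proof -
  have "istopology (\<lambda>S. S \<subseteq> q ` topspace X \<and> openin X {x \<in> topspace X. q x \<in> S})"
    unfolding istopology_def
  proof (intro conjI allI impI)
    fix S T
    assume S: "S \<subseteq> q ` topspace X \<and> openin X {x \<in> topspace X. q x \<in> S}"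
      and T: "T \<subseteq> q ` topspace X \<and> openin X {x \<in> topspace X. q x \<in> T}"
    show "S \<inter> T \<subseteq> q ` topspace X" using S by blast
    have "{x \<in> topspace X. q x \<in> S \<inter> T} =
        {x \<in> topspace X. q x \<in> S} \<inter> {x \<in> topspace X. q x \<in> T}" by blast
    then show "openin X {x \<in> topspace X. q x \<in> S \<inter> T}" using S T by auto
  next
    fix \<K>
    assume K: "\<forall>S\<in>\<K>. S \<subseteq> q ` topspace X \<and> openin X {x \<in> topspace X. q x \<in> S}"
    then show "\<Union>\<K> \<subseteq> q ` topspace X" by blast
    have "{x \<in> topspace X. q x \<in> \<Union>\<K>} = (\<Union>S\<in>\<K>. {x \<in> topspace X. q x \<in> S})" by blast
    then show "openin X {x \<in> topspace X. q x \<in> \<Union>\<K>}" using K by auto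
  qed
  then show ?thesis unfolding quotient_topology_def by simp
qed

lemma topspace_quotient_topology: "topspace (quotient_topology X q) = q ` topspace X"
proof -
  have "{x \<in> topspace X. q x \<in> q ` topspace X} = topspace X" by blast
  then have "openin (quotient_topology X q) (q ` topspace X)"
    by (simp add: openin_quotient_topology)
  then show ?thesis
    by (metis openin_quotient_topology openin_subset openin_topspace subset_antisym)
qed

text \<open>
  The points of the geometric quotient are the orbits, and its Zariski topology is the quotient
  topology.
\<close>

definition moduli_space :: "nat \<Rightarrow> 3 mpoly set set topology" where
  "moduli_space d =
     quotient_topology (subtopology (curve_zariski d) (smooth_curves d)) curve_orbit"

definition plane_param :: "(complex^4) set \<Rightarrow> complex^3^4 \<Rightarrow> bool" where
  "plane_param H M \<longleftrightarrow> inj ((*v) M) \<and> range ((*v) M) = hyperplane_cone H"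

text \<open>
  The equation of the section in coordinates on \<open>H\<close>.  Two parametrizations of \<open>H\<close> differ by an
  invertible matrix, so the orbit of the plane curve does not depend on the choice.
\<close>

definition plane_section :: "4 mpoly \<Rightarrow> (complex^4) set \<Rightarrow> 3 mpoly" where
  "plane_section f H = linear_pullback (SOME M. plane_param H M) f"

definition section_domain :: "nat \<Rightarrow> 4 mpoly \<Rightarrow> (complex^4) set set" where
  "section_domain d f = {H \<in> proj_space. smooth_form d (plane_section f H)}"

definition hyperplane_section_map :: "4 mpoly \<Rightarrow> (complex^4) set \<Rightarrow> 3 mpoly set set" where
  "hyperplane_section_map f H = curve_orbit (curve_pt (plane_section f H))"

text \<open>
  For a map \<open>\<phi>\<close> with domain of definition \<open>U\<close> and values in \<open>Y\<close>: the fibres over a nonempty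
  dense open subset of the image are finite.
\<close>

definition generically_finite_onto_image :: "'b topology \<Rightarrow> 'a set \<Rightarrow> ('a \<Rightarrow> 'b) \<Rightarrow> bool" where
  "generically_finite_onto_image Y U \<phi> \<longleftrightarrow>
     \<phi> ` U \<subseteq> topspace Y \<and>
     (\<exists>V. openin (subtopology Y (\<phi> ` U)) V \<and> V \<noteq> {} \<and>
          (subtopology Y (\<phi> ` U)) closure_of V = \<phi> ` U \<and>
          (\<forall>y\<in>V. finite {x \<in> U. \<phi> x = y}))"

end

theory Submission
  imports Defs "HOL-Computational_Algebra.Polynomial"
begin

text \<open>
  Parametrize planes by injective \<open>4 \<times> 3\<close> matrices \<open>M\<close> and consider \<open>M \<mapsto> f \<circ> M\<close>.  Its differential
  is injective at a parametrization \<open>M\<^sub>0\<close> of the plane \<open>H'\<close>.  If \<open>N\<close> lies in the kernel, evaluate at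
  the nodes of \<open>g = f \<circ> M\<^sub>0\<close>: the gradient of \<open>f\<close> there is a nonzero multiple of the equation of \<open>H'\<close>,
  because \<open>H'\<close> avoids the singular points of \<open>X\<close>, so \<open>N\<close> maps the nodes into \<open>H'\<close>; as the nodes are
  not collinear, \<open>N = M\<^sub>0 B\<close> for a square matrix \<open>B\<close>, which is a linear syzygy \<open>\<Sum>\<^sub>j (B y)\<^sub>j \<partial>\<^sub>jg = 0\<close>.
  At every node such a \<open>B\<close> has the node as an eigenvector, with an eigenvalue \<open>\<beta>\<close> that satisfies
  \<open>(d - 3) \<beta> = - trace B\<close>.  Hence \<open>B\<close> is a scalar, and then \<open>B = 0\<close>.

  Injectivity provides twelve values of \<open>f \<circ> M\<close> that fill an open set, and are thus algebraically
  independent.  Every entry of \<open>M\<close> is algebraic over them, so \<open>M \<mapsto> f \<circ> M\<close> has finite fibres where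
  the leading coefficients of these relations do not vanish.  The \<open>GL\<^sub>3\<close>-saturation of this locus is
  Zariski open.  It meets the image because a plane outside the dual hypersurface of \<open>X\<close> and
  off the singular points of \<open>X\<close> has a smooth section.
\<close>

subsection \<open>Evaluation and differentiation of polynomials\<close>

text \<open>The twelve entries of \<open>M\<close> carry a plane (three parameters) together with
  coordinates on it (nine, for \<open>GL\<^sub>3\<close>). Equality of sections in the moduli space
  thus becomes an equality \<open>f \<circ> M = g\<close> of forms, and fibres can be counted
  without a dimension theory for the quotient. The eigenvalue formula is a sum: the node contributes
  \<beta>, and Euler's identity forces the trace \<open>- (d - 2) \<beta>\<close> on the tangent
  plane, so \<open>trace B\<close> is \<open>- (d - 3) \<beta>\<close>. As \<open>d\<close> is not
  3, all nodes share one eigenvalue; for the triangle \<open>xyz\<close> of degree three every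
  traceless diagonal matrix is a syzygy. A scalar matrix satisfies
  \<open>3 \<beta> = - (d - 3) \<beta>\<close>, that is, \<open>d \<beta> = 0\<close>. The obstacle
  at the end is that the polynomial that certifies finite fibres is not invariant under coordinate
  changes, while open sets of the moduli space come from invariant open sets of curves. A union over
  all coordinate changes repairs this and stays open.\<close>

definition mon :: "('v \<Rightarrow> 'r::comm_ring_1) \<Rightarrow> 'v monom \<Rightarrow> 'r" where
  "mon x m = (\<Prod>i\<in>Poly_Mapping.keys m. x i ^ Poly_Mapping.lookup m i)"

lemma mon_superset:
  assumes "finite A" "Poly_Mapping.keys m \<subseteq> A"
  shows "mon x m = (\<Prod>i\<in>A. x i ^ Poly_Mapping.lookup m i)"
  unfolding mon_def by (rule prod.mono_neutral_left) (use assms in \<open>auto simp: in_keys_iff\<close>)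

lemma mon_UNIV: "mon x m = (\<Prod>i\<in>UNIV. x i ^ Poly_Mapping.lookup m (i :: 'v::finite))"
  by (rule mon_superset) auto

lemma mon_add: "mon x (m + n) = mon x m * mon x n"
proof -
  let ?A = "Poly_Mapping.keys m \<union> Poly_Mapping.keys n"
  have "mon x (m + n) = (\<Prod>i\<in>?A. x i ^ Poly_Mapping.lookup (m + n) i)"
    by (rule mon_superset) (auto simp: keys_add)
  also have "\<dots> = (\<Prod>i\<in>?A. x i ^ Poly_Mapping.lookup m i) * (\<Prod>i\<in>?A. x i ^ Poly_Mapping.lookup n i)"
    by (simp add: lookup_add power_add prod.distrib)
  also have "\<dots> = mon x m * mon x n"
    by (subst (1 2) mon_superset[symmetric]) auto
  finally show ?thesis .
qed

lemma mon_zero [simp]: "mon x 0 = 1"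
  by (simp add: mon_def)

lemma mon_single [simp]: "mon x (Poly_Mapping.single i k) = x i ^ k"
  by (cases "k = 0") (simp_all add: mon_def)

lemma mon_scale: "mon (\<lambda>i. t * x i) m = t ^ mdeg m * mon x m"
  by (simp add: mon_def mdeg_def power_mult_distrib prod.distrib power_sum)

lemma mp_eval_superset:
  assumes "\<kappa> 0 = 0" "finite A" "Poly_Mapping.keys f \<subseteq> A"
  shows "mp_eval \<kappa> x f = (\<Sum>m\<in>A. \<kappa> (Poly_Mapping.lookup f m) * mon x m)"
  unfolding mp_eval_def mon_def[symmetric]
  by (rule sum.mono_neutral_left) (use assms in \<open>auto simp: in_keys_iff\<close>)

lemma sum_singles: "(\<Sum>m\<in>Poly_Mapping.keys f. Poly_Mapping.single m (Poly_Mapping.lookup f m)) = f"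
  by (rule poly_mapping_eqI) (simp add: lookup_sum lookup_single when_def in_keys_iff)

text \<open>Meant for two coefficient maps: the identity, for evaluation at points, and
  \<open>Const\<close>, for substitution of polynomials.\<close>

definition ring_map :: "(complex \<Rightarrow> 'r::comm_ring_1) \<Rightarrow> bool" where
  "ring_map \<kappa> \<longleftrightarrow> \<kappa> 1 = 1 \<and> (\<forall>a b. \<kappa> (a + b) = \<kappa> a + \<kappa> b) \<and> (\<forall>a b. \<kappa> (a * b) = \<kappa> a * \<kappa> b)"

lemma ring_map_id: "ring_map (\<lambda>c. c)"
  by (simp add: ring_map_def)

lemma ring_map_Const: "ring_map Const"
  by (simp add: ring_map_def Const_def single_add mult_single)

lemma ring_map_zero: "ring_map \<kappa> \<Longrightarrow> \<kappa> 0 = 0"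
  unfolding ring_map_def by (metis add_cancel_right_right add_0)

context
  fixes \<kappa> :: "complex \<Rightarrow> 'r::comm_ring_1"
  assumes \<kappa>: "ring_map \<kappa>"
begin

lemma mp_eval_zero [simp]: "mp_eval \<kappa> x 0 = 0"
  by (simp add: mp_eval_def)

lemma mp_eval_add: "mp_eval \<kappa> x (f + g) = mp_eval \<kappa> x f + mp_eval \<kappa> x g"
proof -
  let ?A = "Poly_Mapping.keys f \<union> Poly_Mapping.keys g"
  have k: "\<kappa> 0 = 0" by (rule ring_map_zero[OF \<kappa>])
  have "mp_eval \<kappa> x (f + g) = (\<Sum>m\<in>?A. \<kappa> (Poly_Mapping.lookup (f + g) m) * mon x m)"
    by (rule mp_eval_superset[where \<kappa>=\<kappa>, OF k]) (auto simp: keys_add)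
  also have "\<dots> = (\<Sum>m\<in>?A. \<kappa> (Poly_Mapping.lookup f m) * mon x m)
      + (\<Sum>m\<in>?A. \<kappa> (Poly_Mapping.lookup g m) * mon x m)"
    using \<kappa> by (simp add: lookup_add ring_map_def sum.distrib distrib_right)
  also have "\<dots> = mp_eval \<kappa> x f + mp_eval \<kappa> x g"
    by (subst (1 2) mp_eval_superset[where \<kappa>=\<kappa>, OF k, symmetric]) auto
  finally show ?thesis .
qed

lemma mp_eval_sum: "mp_eval \<kappa> x (sum F S) = (\<Sum>s\<in>S. mp_eval \<kappa> x (F s))"
  by (induction S rule: infinite_finite_induct) (simp_all add: mp_eval_add)

lemma mp_eval_single: "mp_eval \<kappa> x (Poly_Mapping.single m c) = \<kappa> c * mon x m"
  using ring_map_zero[OF \<kappa>] by (cases "c = 0") (simp_all add: mp_eval_def mon_def)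

lemma mp_eval_Const [simp]: "mp_eval \<kappa> x (Const c) = \<kappa> c"
  by (simp add: Const_def mp_eval_single)

lemma mp_eval_Var [simp]: "mp_eval \<kappa> x (Var i) = x i"
  using \<kappa> by (simp add: Var_def mp_eval_single ring_map_def)

lemma mp_eval_mult: "mp_eval \<kappa> x (f * g) = mp_eval \<kappa> x f * mp_eval \<kappa> x g"
proof -
  let ?s = "\<lambda>f m. Poly_Mapping.single m (Poly_Mapping.lookup f m)"
  have "f * g = (\<Sum>m\<in>Poly_Mapping.keys f. ?s f m) * (\<Sum>n\<in>Poly_Mapping.keys g. ?s g n)"
    by (simp add: sum_singles)
  also have "\<dots> = (\<Sum>m\<in>Poly_Mapping.keys f. \<Sum>n\<in>Poly_Mapping.keys g. ?s f m * ?s g n)"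
    by (simp add: sum_product)
  finally have "mp_eval \<kappa> x (f * g) = (\<Sum>m\<in>Poly_Mapping.keys f. \<Sum>n\<in>Poly_Mapping.keys g.
      mp_eval \<kappa> x (?s f m) * mp_eval \<kappa> x (?s g n))"
    using \<kappa> by (simp add: mp_eval_sum mult_single mp_eval_single mon_add ring_map_def mult_ac)
  also have "\<dots> = mp_eval \<kappa> x (\<Sum>m\<in>Poly_Mapping.keys f. ?s f m) * mp_eval \<kappa> x (\<Sum>n\<in>Poly_Mapping.keys g. ?s g n)"
    by (simp add: mp_eval_sum sum_product)
  finally show ?thesis by (simp add: sum_singles)
qed

lemma mp_eval_one [simp]: "mp_eval \<kappa> x 1 = 1"
  using mp_eval_Const[of x 1] \<kappa> by (simp add: Const_def ring_map_def)

lemma mp_eval_power: "mp_eval \<kappa> x (f ^ n) = mp_eval \<kappa> x f ^ n"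
  by (induction n) (simp_all add: mp_eval_mult)

lemma mp_eval_prod: "mp_eval \<kappa> x (prod F S) = (\<Prod>s\<in>S. mp_eval \<kappa> x (F s))"
  by (induction S rule: infinite_finite_induct) (simp_all add: mp_eval_mult)

end

lemmas eval_zero [simp] = mp_eval_zero[OF ring_map_id]
lemmas eval_Const [simp] = mp_eval_Const[OF ring_map_id]
lemmas eval_Var [simp] = mp_eval_Var[OF ring_map_id]
lemmas eval_add = mp_eval_add[OF ring_map_id]
lemmas eval_mult = mp_eval_mult[OF ring_map_id]
lemmas eval_sum = mp_eval_sum[OF ring_map_id]
lemmas eval_prod = mp_eval_prod[OF ring_map_id]
lemmas eval_power = mp_eval_power[OF ring_map_id]
lemmas eval_single = mp_eval_single[OF ring_map_id]

lemma eval_mon: "eval x f = (\<Sum>m\<in>Poly_Mapping.keys f. Poly_Mapping.lookup f m * mon x m)"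
  by (simp add: mp_eval_def mon_def)

lemma eval_minus: "eval x (f - g) = eval x f - eval x g"
  using eval_add[of x "f - g" g] by simp

lemma eval_subst_mp: "eval y (subst_mp \<sigma> f) = eval (\<lambda>i. eval y (\<sigma> i)) f"
  unfolding mp_eval_def[of Const] mp_eval_def[of "\<lambda>c. c" "\<lambda>i. eval y (\<sigma> i)"]
  by (simp add: eval_sum eval_mult eval_prod eval_power)

lemma eval_linear_form: "eval y (linear_form a) = (\<Sum>j\<in>UNIV. a $ j * y j)"
  by (simp add: linear_form_def eval_sum eval_mult)

lemma eval_affine_pullback:
  "eval (($) y) (affine_pullback v M f) = eval (($) (v + M *v y)) f"
  by (simp add: affine_pullback_def eval_subst_mp eval_add eval_linear_form matrix_vector_mult_def
      cong: sum.cong)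
     (rule arg_cong[where f="\<lambda>x. eval x f"], auto)

lemma eval_scale_homogeneous:
  assumes "homogeneous d f"
  shows "eval (\<lambda>i. t * x i) f = t ^ d * eval x f"
  using assms by (simp add: eval_mon mon_scale homogeneous_def sum_distrib_left mult_ac cong: sum.cong)

lemma eval_pderiv: "eval x (pderiv_mp i f) =
   (\<Sum>m\<in>Poly_Mapping.keys f. of_nat (Poly_Mapping.lookup m i) * Poly_Mapping.lookup f m * mon x (m - Poly_Mapping.single i 1))"
  by (simp add: pderiv_mp_def eval_sum eval_single)

lemma lookup_pderiv: "Poly_Mapping.lookup (pderiv_mp i f) m =
   of_nat (Poly_Mapping.lookup m i + 1) * Poly_Mapping.lookup f (m + Poly_Mapping.single i 1)"
proof -
  let ?e = "Poly_Mapping.single i (1::nat)"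
  \<comment> \<open>The subtraction \<open>n - ?e\<close> truncates at monomials without the
    variable \<open>i\<close>, but these carry the factor \<open>lookup n i = 0\<close>.\<close>
  have *: "(of_nat (Poly_Mapping.lookup n i) * Poly_Mapping.lookup f n when n - ?e = m)
     = (of_nat (Poly_Mapping.lookup m i + 1) * Poly_Mapping.lookup f (m + ?e) when n = m + ?e)" for n
  proof (cases "Poly_Mapping.lookup n i = 0")
    case True
    have "n \<noteq> m + ?e"
    proof
      assume "n = m + ?e"
      then have "Poly_Mapping.lookup n i = Poly_Mapping.lookup m i + 1" by (simp add: lookup_add)
      with True show False by simp
    qed
    with True show ?thesis by simp
  next
    case False
    have "n - ?e = m \<longleftrightarrow> n = m + ?e"
    proof
      assume "n - ?e = m"
      then show "n = m + ?e" using False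
        by (auto intro!: poly_mapping_eqI simp: lookup_add lookup_minus lookup_single when_def)
    qed simp
    then show ?thesis by (auto simp: when_def lookup_add)
  qed
  have "Poly_Mapping.lookup (pderiv_mp i f) m = (\<Sum>n\<in>Poly_Mapping.keys f.
      of_nat (Poly_Mapping.lookup m i + 1) * Poly_Mapping.lookup f (m + ?e) when n = m + ?e)"
    by (simp only: pderiv_mp_def lookup_sum lookup_single *)
  also have "\<dots> = of_nat (Poly_Mapping.lookup m i + 1) * Poly_Mapping.lookup f (m + ?e)"
    by (simp add: when_def in_keys_iff)
  finally show ?thesis .
qed

text \<open>Ties the formal partial derivatives to the analytic derivative. Chain and product rules
  can then be read off from uniqueness of derivatives instead of being computed on
  monomials.\<close>

lemma has_derivative_eval:
  fixes x :: "complex^'v::finite"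
  shows "((\<lambda>x. eval (($) x) f) has_derivative
    (\<lambda>w. \<Sum>i\<in>UNIV. eval (($) x) (pderiv_mp i f) * w $ i)) (at x)"
proof -
  have m: "((\<lambda>x. mon (($) x) m) has_derivative
    (\<lambda>w. \<Sum>i\<in>UNIV. of_nat (Poly_Mapping.lookup m i) * mon (($) x) (m - Poly_Mapping.single i 1) * w $ i)) (at x)"
    for m :: "'v monom"
  proof -
    have "((\<lambda>x. mon (($) x) m) has_derivative (\<lambda>w. \<Sum>i\<in>UNIV. (of_nat (Poly_Mapping.lookup m i) * w $ i * x $ i ^ (Poly_Mapping.lookup m i - 1)) *
        (\<Prod>j\<in>UNIV - {i}. x $ j ^ Poly_Mapping.lookup m j))) (at x)"
      unfolding mon_UNIV
      by (rule has_derivative_prod) (auto intro!: derivative_eq_intros bounded_linear_imp_has_derivative bounded_linear_vec_nth)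
    moreover have "mon (($) x) (m - Poly_Mapping.single i 1) = x $ i ^ (Poly_Mapping.lookup m i - 1) *
        (\<Prod>j\<in>UNIV - {i}. x $ j ^ Poly_Mapping.lookup m j)" for i
      unfolding mon_UNIV
      by (subst prod.remove[of _ i]) (auto simp: lookup_minus lookup_single intro!: prod.cong)
    ultimately show ?thesis by (simp add: mult_ac)
  qed
  have "((\<lambda>x. eval (($) x) f) has_derivative
    (\<lambda>w. \<Sum>m\<in>Poly_Mapping.keys f. Poly_Mapping.lookup f m * (\<Sum>i\<in>UNIV. of_nat (Poly_Mapping.lookup m i) * mon (($) x) (m - Poly_Mapping.single i 1) * w $ i))) (at x)"
    unfolding eval_mon by (intro has_derivative_sum has_derivative_mult_right m)
  moreover have "(\<Sum>m\<in>Poly_Mapping.keys f. Poly_Mapping.lookup f m * (\<Sum>i\<in>UNIV. of_nat (Poly_Mapping.lookup m i) * mon (($) x) (m - Poly_Mapping.single i 1) * w $ i))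
    = (\<Sum>i\<in>UNIV. eval (($) x) (pderiv_mp i f) * w $ i)" for w :: "complex^'v"
    unfolding eval_pderiv sum_distrib_left sum_distrib_right
    by (subst sum.swap) (simp add: mult_ac)
  ultimately show ?thesis by simp
qed

subsection \<open>Polynomial functions and algebraic dependence\<close>

lemma mdeg_superset:
  assumes "finite A" "Poly_Mapping.keys m \<subseteq> A"
  shows "mdeg m = (\<Sum>i\<in>A. Poly_Mapping.lookup m i)"
  unfolding mdeg_def by (rule sum.mono_neutral_left) (use assms in \<open>auto simp: in_keys_iff\<close>)

lemma mdeg_add: "mdeg (m + n) = mdeg m + mdeg n"
proof -
  let ?A = "Poly_Mapping.keys m \<union> Poly_Mapping.keys n"
  have "mdeg (m + n) = (\<Sum>i\<in>?A. Poly_Mapping.lookup (m + n) i)"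
    by (rule mdeg_superset) (auto simp: keys_add)
  also have "\<dots> = mdeg m + mdeg n"
    by (simp add: mdeg_superset[of ?A] lookup_add sum.distrib)
  finally show ?thesis .
qed

lemma mdeg_zero [simp]: "mdeg 0 = 0"
  by (simp add: mdeg_def)

lemma mdeg_single [simp]: "mdeg (Poly_Mapping.single i k) = k"
  by (cases "k = 0") (simp_all add: mdeg_def)

lemma lookup_le_mdeg: "Poly_Mapping.lookup m i \<le> mdeg m"
  by (cases "i \<in> Poly_Mapping.keys m")
     (auto simp: mdeg_def in_keys_iff intro: member_le_sum)

lemma eval_pderiv_zero:
  fixes x :: "complex^'v::finite"
  assumes "\<And>x::complex^'v. eval (($) x) f = 0"
  shows "eval (($) x) (pderiv_mp i f) = 0"
proof -
  have "((\<lambda>x. 0) has_derivative (\<lambda>w. \<Sum>j\<in>UNIV. eval (($) x) (pderiv_mp j f) * w $ j)) (at x)"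
    using has_derivative_eval[of f x] assms by simp
  from has_derivative_unique[OF this has_derivative_const]
  have "(\<Sum>j\<in>UNIV. eval (($) x) (pderiv_mp j f) * axis i 1 $ j) = 0"
    by meson
  then show ?thesis by (simp add: axis_def if_distrib cong: if_cong)
qed

text \<open>Induction on a degree bound: the partial derivatives vanish as functions and have
  smaller degree, so they are zero. In characteristic zero this leaves a constant, which vanishes as
  well.\<close>

lemma mpoly_zeroI:
  fixes f :: "'v::finite mpoly"
  assumes "\<And>x. eval x f = 0"
  shows "f = 0"
proof -
  have "f = 0" if "\<forall>m\<in>Poly_Mapping.keys f. mdeg m < N" "\<forall>x::complex^'v. eval (($) x) f = 0"
    for N and f :: "'v mpoly"
    using that
  proof (induction N arbitrary: f)
    case 0
    then show ?case by (metis not_less_zero ex_in_conv keys_eq_empty)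
  next
    case (Suc N)
    have p: "pderiv_mp i f = 0" for i
    proof (rule Suc.IH)
      show "\<forall>x::complex^'v. eval (($) x) (pderiv_mp i f) = 0"
        using eval_pderiv_zero Suc.prems(2) by blast
      show "\<forall>m\<in>Poly_Mapping.keys (pderiv_mp i f). mdeg m < N"
      proof
        fix m assume "m \<in> Poly_Mapping.keys (pderiv_mp i f)"
        then have "m + Poly_Mapping.single i 1 \<in> Poly_Mapping.keys f"
          by (simp add: in_keys_iff lookup_pderiv)
        with Suc.prems(1) show "mdeg m < N" by (fastforce simp: mdeg_add)
      qed
    qed
    have z: "Poly_Mapping.lookup f n = 0" if n0: "n \<noteq> 0" for n
    proof -
      obtain i where i: "Poly_Mapping.lookup n i \<noteq> 0"
        using n0 by (metis poly_mapping_eqI lookup_zero)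
      have "n = (n - Poly_Mapping.single i 1) + Poly_Mapping.single i 1"
        using i by (auto intro!: poly_mapping_eqI simp: lookup_add lookup_minus lookup_single when_def)
      moreover have "Poly_Mapping.lookup f ((n - Poly_Mapping.single i 1) + Poly_Mapping.single i 1) = 0"
        using arg_cong[OF p[of i], of "\<lambda>g. Poly_Mapping.lookup g (n - Poly_Mapping.single i 1)"]
        by (simp add: lookup_pderiv del: of_nat_Suc)
      ultimately show ?thesis by simp
    qed
    then have f: "f = Const (Poly_Mapping.lookup f 0)"
      by (intro poly_mapping_eqI) (auto simp: Const_def lookup_single when_def)
    then have "Poly_Mapping.lookup f 0 = 0"
      using Suc.prems(2) by (metis eval_Const)
    with f show ?case by (simp add: Const_def)
  qed
  moreover have "\<forall>m\<in>Poly_Mapping.keys f. mdeg m < Suc (\<Sum>m\<in>Poly_Mapping.keys f. mdeg m)"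
    by (simp add: less_Suc_eq_le member_le_sum)
  ultimately show ?thesis using assms by blast
qed

lemma mpoly_eqI:
  fixes f g :: "'v::finite mpoly"
  assumes "\<And>x. eval x f = eval x g"
  shows "f = g"
  using mpoly_zeroI[of "f - g"] assms by (simp add: eval_minus)

text \<open>The index type may be infinite: besides matrix entries, the arguments are coefficient
  vectors indexed by all monomials. Nonvanishing is therefore studied along lines, where it concerns
  polynomials in one variable.\<close>

definition polyfun :: "(('v \<Rightarrow> complex) \<Rightarrow> complex) \<Rightarrow> bool" where
  "polyfun p \<longleftrightarrow> (\<exists>F. \<forall>x. p x = eval x F)"

lemma polyfun_eval [simp, intro]: "polyfun (\<lambda>x. eval x F)"
  by (auto simp: polyfun_def)

lemma polyfun_const [simp, intro]: "polyfun (\<lambda>x. c)"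
  by (auto simp: polyfun_def intro!: exI[of _ "Const c"])

lemma polyfun_var [simp, intro]: "polyfun (\<lambda>x. x i)"
  by (auto simp: polyfun_def intro!: exI[of _ "Var i"])

lemma polyfun_add [intro]: "polyfun p \<Longrightarrow> polyfun q \<Longrightarrow> polyfun (\<lambda>x. p x + q x)"
  unfolding polyfun_def by (metis eval_add)

lemma polyfun_mult [intro]: "polyfun p \<Longrightarrow> polyfun q \<Longrightarrow> polyfun (\<lambda>x. p x * q x)"
  unfolding polyfun_def by (metis eval_mult)

lemma polyfun_sum [intro]: "(\<And>i. i \<in> S \<Longrightarrow> polyfun (p i)) \<Longrightarrow> polyfun (\<lambda>x. \<Sum>i\<in>S. p i x)"
  by (induction S rule: infinite_finite_induct) auto

lemma polyfun_prod [intro]: "(\<And>i. i \<in> S \<Longrightarrow> polyfun (p i)) \<Longrightarrow> polyfun (\<lambda>x. \<Prod>i\<in>S. p i x)"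
  by (induction S rule: infinite_finite_induct) auto

lemma polyfun_power [intro]: "polyfun p \<Longrightarrow> polyfun (\<lambda>x. p x ^ k)"
  by (induction k) auto

lemma polyfun_compose:
  assumes "polyfun p" "\<And>i. polyfun (q i)"
  shows "polyfun (\<lambda>x. p (\<lambda>i. q i x))"
proof -
  obtain F where F: "\<And>x. p x = eval x F" using assms(1) by (auto simp: polyfun_def)
  have "\<exists>G. \<forall>i x. q i x = eval x (G i)"
    using assms(2) unfolding polyfun_def by metis
  then obtain G where G: "\<And>i x. q i x = eval x (G i)" by blast
  show ?thesis unfolding polyfun_def
    by (rule exI[of _ "subst_mp G F"]) (simp add: eval_subst_mp F G)
qed

lemma polyfun_line:
  assumes "polyfun p"
  obtains P :: "complex poly" where "\<And>t. p (\<lambda>i. x i + t * w i) = poly P t"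
proof -
  obtain F where F: "\<And>x. p x = eval x F" using assms by (auto simp: polyfun_def)
  show ?thesis
    by (rule that[of "\<Sum>m\<in>Poly_Mapping.keys F. Polynomial.smult (Poly_Mapping.lookup F m)
          (\<Prod>i\<in>Poly_Mapping.keys m. [:x i, w i:] ^ Poly_Mapping.lookup m i)"])
       (simp add: F mp_eval_def poly_sum poly_prod)
qed

text \<open>On the line through \<open>a\<close> and \<open>b\<close> both functions become nonzero
  polynomials in one variable, whose product has a nonroot. This is the irreducibility of affine
  space.\<close>

lemma polyfun_common_nonzero:
  assumes "polyfun p" "polyfun q" "p a \<noteq> 0" "q b \<noteq> 0"
  shows "\<exists>x. p x \<noteq> 0 \<and> q x \<noteq> 0"
proof -
  obtain P where P: "\<And>t. p (\<lambda>i. a i + t * (b i - a i)) = poly P t"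
    using polyfun_line[OF assms(1), of a "\<lambda>i. b i - a i"] by blast
  obtain Q where Q: "\<And>t. q (\<lambda>i. a i + t * (b i - a i)) = poly Q t"
    using polyfun_line[OF assms(2), of a "\<lambda>i. b i - a i"] by blast
  have "P \<noteq> 0" "Q \<noteq> 0" using P[of 0] Q[of 1] assms(3,4) by auto
  then have "P * Q \<noteq> 0" by simp
  then obtain t where "poly (P * Q) t \<noteq> 0" using poly_all_0_iff_0 by blast
  then have "poly P t \<noteq> 0" "poly Q t \<noteq> 0" by simp_all
  then show ?thesis using P[of t] Q[of t] by (intro exI[of _ "\<lambda>i. a i + t * (b i - a i)"]) simp
qed

lemma polyfun_common_nonzero_set:
  assumes "finite I" "\<And>i. i \<in> I \<Longrightarrow> polyfun (p i)" "\<And>i. i \<in> I \<Longrightarrow> \<exists>x. p i x \<noteq> 0"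
  shows "\<exists>x. \<forall>i\<in>I. p i x \<noteq> 0"
proof -
  have "\<exists>x. (\<Prod>i\<in>I. p i x) \<noteq> 0" using assms
  proof (induction I rule: finite_induct)
    case (insert j I)
    obtain a b where "p j a \<noteq> 0" "(\<Prod>i\<in>I. p i b) \<noteq> 0" using insert by blast
    then have "\<exists>x. p j x \<noteq> 0 \<and> (\<Prod>i\<in>I. p i x) \<noteq> 0"
      using insert.prems by (intro polyfun_common_nonzero) auto
    then show ?case using insert.hyps by auto
  qed simp
  then show ?thesis using assms(1) by auto
qed

section \<open>Linear systems and the counting of monomials\<close>

lemma homogeneous_system_nontrivial:
  fixes M :: "'b \<Rightarrow> 'a \<Rightarrow> 'k::field"
  assumes "finite B" "finite A" "card B < card A"
  shows "\<exists>r. (\<exists>a\<in>A. r a \<noteq> 0) \<and> (\<forall>b\<in>B. (\<Sum>a\<in>A. M b a * r a) = 0)"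
  using assms
proof (induction B arbitrary: A M rule: finite_induct)
  case empty
  then have "A \<noteq> {}" by auto
  then show ?case by (intro exI[of _ "\<lambda>_. 1"]) auto
next
  case (insert b0 B)
  show ?case
  proof (cases "\<forall>a\<in>A. M b0 a = 0")
    case True
    have "card B < card A" using insert by simp
    then obtain r where "\<exists>a\<in>A. r a \<noteq> 0" "\<forall>b\<in>B. (\<Sum>a\<in>A. M b a * r a) = 0"
      using insert.IH[OF insert.prems(1), of M] by blast
    with True show ?thesis by (intro exI[of _ r]) simp
  next
    case False
    then obtain a0 where a0: "a0 \<in> A" "M b0 a0 \<noteq> 0" by blast
    let ?A = "A - {a0}"
    have "card B < card ?A" using insert a0 by simp
    then have "\<exists>r. (\<exists>a\<in>?A. r a \<noteq> 0) \<and> (\<forall>b\<in>B. (\<Sum>a\<in>?A. (M b a - M b a0 * M b0 a / M b0 a0) * r a) = 0)"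
      using insert.prems by (intro insert.IH) auto
    then obtain r where r: "\<exists>a\<in>?A. r a \<noteq> 0"
      "\<And>b. b \<in> B \<Longrightarrow> (\<Sum>a\<in>?A. (M b a - M b a0 * M b0 a / M b0 a0) * r a) = 0" by blast
    \<comment> \<open>Gaussian elimination: the equation \<open>b0\<close>, with pivot
      \<open>M b0 a0\<close>, determines the unknown \<open>a0\<close> from a solution of the
      reduced system.\<close>
    let ?r = "r(a0 := - (\<Sum>a\<in>?A. M b0 a * r a) / M b0 a0)"
    have s: "(\<Sum>a\<in>A. M b a * ?r a) = M b a0 * ?r a0 + (\<Sum>a\<in>?A. M b a * r a)" for b
    proof -
      have "(\<Sum>a\<in>?A. M b a * ?r a) = (\<Sum>a\<in>?A. M b a * r a)" by (rule sum.cong) auto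
      then show ?thesis using sum.remove[OF insert.prems(1) a0(1), of "\<lambda>a. M b a * ?r a"] by simp
    qed
    have "(\<Sum>a\<in>A. M b a * ?r a) = 0" if "b \<in> insert b0 B" for b
    proof (cases "b = b0")
      case True
      then show ?thesis using a0 by (simp only: s) simp
    next
      case False
      then have "b \<in> B" using that by simp
      have "(\<Sum>a\<in>?A. (M b a - M b a0 * M b0 a / M b0 a0) * r a)
        = (\<Sum>a\<in>?A. M b a * r a) - M b a0 / M b0 a0 * (\<Sum>a\<in>?A. M b0 a * r a)"
        by (simp add: left_diff_distrib sum_subtractf right_diff_distrib sum_distrib_left sum_divide_distrib mult_ac)
      with r(2)[OF \<open>b \<in> B\<close>] show ?thesis by (simp only: s) (simp add: field_simps)
    qed
    moreover have "\<exists>a\<in>A. ?r a \<noteq> 0" using r(1) by auto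
    ultimately show ?thesis by blast
  qed
qed

text \<open>Bounding each exponent separately, rather than the total degree, makes the number of
  monomials an exact power of \<open>N\<close>.\<close>

definition monom_box :: "nat \<Rightarrow> 'v::finite monom set" where
  "monom_box N = {m. \<forall>i. Poly_Mapping.lookup m i < N}"

lemma monom_box_card: "finite (monom_box N :: 'v::finite monom set) \<and>
    card (monom_box N :: 'v monom set) = N ^ CARD('v)"
proof -
  have "bij_betw Poly_Mapping.lookup (monom_box N :: 'v monom set) (PiE UNIV (\<lambda>_. {..<N}))"
    by (rule bij_betw_byWitness[where f' = Abs_poly_mapping])
       (auto simp: monom_box_def lookup_inverse)
  then show ?thesis
    using bij_betw_finite bij_betw_same_card by (fastforce simp: card_PiE finite_PiE)
qed

lemma mdeg_mult_le:
  assumes "\<forall>m\<in>Poly_Mapping.keys F. mdeg m \<le> a" "\<forall>m\<in>Poly_Mapping.keys G. mdeg m \<le> b"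
  shows "\<forall>m\<in>Poly_Mapping.keys (F * G). mdeg m \<le> a + b"
  using keys_mult[of F G] assms by (fastforce simp: mdeg_add intro: add_mono)

lemma mdeg_power_le:
  assumes "\<forall>m\<in>Poly_Mapping.keys F. mdeg m \<le> a"
  shows "\<forall>m\<in>Poly_Mapping.keys (F ^ k). mdeg m \<le> a * k"
proof (induction k)
  case (Suc k)
  then show ?case using mdeg_mult_le[OF assms Suc] by simp
qed simp

lemma mdeg_prod_le:
  assumes "\<And>i. i \<in> S \<Longrightarrow> \<forall>m\<in>Poly_Mapping.keys (F i). mdeg m \<le> a i"
  shows "\<forall>m\<in>Poly_Mapping.keys (\<Prod>i\<in>S. F i). mdeg m \<le> (\<Sum>i\<in>S. a i)"
  using assms
proof (induction S rule: infinite_finite_induct)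
  case (insert j S)
  then show ?case using mdeg_mult_le[of "F j" "a j" "\<Prod>i\<in>S. F i" "\<Sum>i\<in>S. a i"] by auto
qed simp_all

lemma lookup_Const_mult: "Poly_Mapping.lookup (Const c * F) m = c * Poly_Mapping.lookup F m"
  by (simp add: Const_def mult_map_scale_conv_mult[symmetric] Poly_Mapping.map.rep_eq when_def)

text \<open>
  Among the \<open>D\<^sup>n\<^sup>+\<^sup>1\<close> products \<open>P\<^sup>k T\<^sup>b\<close> with all exponents below \<open>D\<close> only \<open>O(D\<^sup>n)\<close> monomials occur.
\<close>

lemma algebraic_dependence:
  fixes P :: "'v::finite mpoly" and T :: "'v \<Rightarrow> 'v mpoly"
  obtains D :: nat and R :: "nat \<Rightarrow> 'v mpoly"
  where "\<exists>k<D. R k \<noteq> 0" "\<And>x. (\<Sum>k<D. eval (\<lambda>i. eval x (T i)) (R k) * eval x P ^ k) = 0"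
proof -
  let ?n = "CARD('v)"
  define e where "e = Suc (\<Sum>F\<in>insert P (range T). \<Sum>m\<in>Poly_Mapping.keys F. mdeg m)"
  \<comment> \<open>\<open>D\<close> exceeds \<open>(e * (?n + 1)) ^ ?n\<close>, so the
    \<open>D ^ (?n + 1)\<close> products outnumber the \<open>N ^ ?n\<close> monomials of the box
    that contains all that occur. The \<open>Suc\<close> in \<open>e\<close> keeps it positive,
    which makes the degree bound strict.\<close>
  define D where "D = (e * (?n + 1)) ^ ?n + 1"
  define N where "N = e * (?n + 1) * D"
  have e: "\<forall>m\<in>Poly_Mapping.keys F. mdeg m \<le> e" if "F \<in> insert P (range T)" for F
  proof
    fix m assume "m \<in> Poly_Mapping.keys F"
    then have "mdeg m \<le> (\<Sum>m\<in>Poly_Mapping.keys F. mdeg m)" by (simp add: member_le_sum)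
    also have "\<dots> \<le> (\<Sum>F\<in>insert P (range T). \<Sum>m\<in>Poly_Mapping.keys F. mdeg m)"
      using that by (intro member_le_sum) auto
    finally show "mdeg m \<le> e" by (simp add: e_def)
  qed
  define A where "A = {..<D} \<times> (monom_box D :: 'v monom set)"
  define Q where "Q = (\<lambda>(k, b). P ^ k * (\<Prod>i\<in>UNIV. T i ^ Poly_Mapping.lookup b i))"
  have Q: "Poly_Mapping.keys (Q a) \<subseteq> monom_box N" if "a \<in> A" for a
  proof
    fix m assume m: "m \<in> Poly_Mapping.keys (Q a)"
    obtain k b where a: "a = (k, b)" by (cases a)
    have kb: "k < D" "\<And>i. Poly_Mapping.lookup b i < D" using that a by (auto simp: A_def monom_box_def)
    have "\<forall>m\<in>Poly_Mapping.keys (Q a). mdeg m \<le> e * k + (\<Sum>i\<in>UNIV. e * Poly_Mapping.lookup b i)"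
      unfolding a Q_def prod.case by (intro mdeg_mult_le mdeg_power_le mdeg_prod_le e) auto
    then have "mdeg m \<le> e * k + (\<Sum>i\<in>UNIV. e * Poly_Mapping.lookup b i)"
      using m by blast
    also have "\<dots> \<le> e * (D - 1) + (\<Sum>i\<in>(UNIV :: 'v set). e * (D - 1))"
    proof -
      have "k \<le> D - 1" "\<And>i. Poly_Mapping.lookup b i \<le> D - 1"
        using kb(1) kb(2)[THEN Suc_leI] by (simp_all add: le_diff_conv2)
      then show ?thesis by (intro add_mono sum_mono mult_left_mono) auto
    qed
    also have "\<dots> = e * (?n + 1) * (D - 1)" by (simp add: algebra_simps)
    also have "\<dots> < N" unfolding N_def D_def e_def by simp
    finally have "mdeg m < N" .
    then show "m \<in> monom_box N"
      by (simp add: monom_box_def le_less_trans[OF lookup_le_mdeg])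
  qed
  have fA: "finite A" by (simp add: A_def monom_box_card)
  have "card (monom_box N :: 'v monom set) = (e * (?n + 1)) ^ ?n * D ^ ?n"
    by (simp only: monom_box_card N_def power_mult_distrib)
  also have "\<dots> < D * D ^ ?n" by (simp add: D_def)
  also have "\<dots> = card A" by (simp add: A_def card_cartesian_product monom_box_card)
  finally have c: "card (monom_box N :: 'v monom set) < card A" .
  obtain r where r: "\<exists>a\<in>A. r a \<noteq> 0"
      "\<forall>m\<in>(monom_box N :: 'v monom set). (\<Sum>a\<in>A. Poly_Mapping.lookup (Q a) m * r a) = 0"
    using homogeneous_system_nontrivial[OF conjunct1[OF monom_box_card] fA c, of "\<lambda>m a. Poly_Mapping.lookup (Q a) m"]
    by blast
  have zero: "(\<Sum>a\<in>A. Const (r a) * Q a) = 0"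
  proof (rule poly_mapping_eqI)
    fix m
    have "(\<Sum>a\<in>A. Poly_Mapping.lookup (Q a) m * r a) = 0"
    proof (cases "m \<in> monom_box N")
      case False
      then have "Poly_Mapping.lookup (Q a) m = 0" if "a \<in> A" for a
        using Q[OF that] by (auto simp: in_keys_iff)
      then show ?thesis by simp
    qed (use r in blast)
    then show "Poly_Mapping.lookup (\<Sum>a\<in>A. Const (r a) * Q a) m = Poly_Mapping.lookup 0 m"
      by (simp add: lookup_sum lookup_Const_mult) (simp add: mult.commute)
  qed
  \<comment> \<open>The relation is sorted by powers of \<open>P\<close>; the coefficients are
    polynomials in \<open>T\<close>.\<close>
  define R where "R k = (\<Sum>b\<in>monom_box D. Poly_Mapping.single b (r (k, b)))" for k
  show ?thesis
  proof
    obtain k b where kb: "k < D" "b \<in> monom_box D" "r (k, b) \<noteq> 0" using r(1) by (auto simp: A_def)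
    have "Poly_Mapping.lookup (R k) b = (\<Sum>c\<in>monom_box D. if c = b then r (k, c) else 0)"
      by (simp add: R_def lookup_sum lookup_single when_def)
    also have "\<dots> = r (k, b)"
      using kb conjunct1[OF monom_box_card[of D, where 'v='v]] by (subst sum.delta) auto
    finally have "R k \<noteq> 0" using kb by auto
    with kb show "\<exists>k<D. R k \<noteq> 0" by blast
  next
    fix x
    have "0 = eval x (\<Sum>a\<in>A. Const (r a) * Q a)" by (simp add: zero)
    also have "\<dots> = (\<Sum>(k, b)\<in>A. r (k, b) * (eval x P ^ k * mon (\<lambda>i. eval x (T i)) b))"
      by (simp add: eval_sum eval_mult eval_prod eval_power Q_def mon_UNIV case_prod_unfold)
    also have "\<dots> = (\<Sum>k<D. \<Sum>b\<in>monom_box D. r (k, b) * (eval x P ^ k * mon (\<lambda>i. eval x (T i)) b))"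
      by (simp add: A_def sum.cartesian_product)
    also have "\<dots> = (\<Sum>k<D. eval (\<lambda>i. eval x (T i)) (R k) * eval x P ^ k)"
      by (simp add: R_def eval_sum eval_single sum_distrib_left sum_distrib_right mult_ac)
    finally show "(\<Sum>k<D. eval (\<lambda>i. eval x (T i)) (R k) * eval x P ^ k) = 0" by simp
  qed
qed

subsection \<open>Hyperplanes, charts and pullbacks\<close>

text \<open>Complex bilinear without conjugation, as in the equation of a hyperplane, in contrast to
  the real-valued \<open>inner\<close>.\<close>

definition dot :: "complex^'n::finite \<Rightarrow> complex^'n \<Rightarrow> complex" where
  "dot a x = (\<Sum>i\<in>UNIV. a $ i * x $ i)"

lemma dot_add_right: "dot a (x + y) = dot a x + dot a y"
  by (simp add: dot_def distrib_left sum.distrib)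

lemma dot_scale_right: "dot a (c *s x) = c * dot a x"
  by (simp add: dot_def sum_distrib_left mult_ac)

lemma dot_add_left: "dot (a + b) x = dot a x + dot b x"
  by (simp add: dot_def distrib_right sum.distrib)

lemma dot_scale_left: "dot (c *s a) x = c * dot a x"
  by (simp add: dot_def sum_distrib_left mult_ac)

lemma dot_diff_right: "dot a (x - y) = dot a x - dot a y"
  by (simp add: dot_def right_diff_distrib sum_subtractf)

lemma dot_zero [simp]: "dot a 0 = 0" "dot 0 a = 0"
  by (simp_all add: dot_def)

lemma dot_axis [simp]: "dot a (axis i 1) = a $ i"
  by (simp add: dot_def axis_def if_distrib cong: if_cong)

lemma matrix_vector_nth: "(M *v x) $ i = dot (M $ i) x"
  by (simp add: matrix_vector_mult_def dot_def)

lemma dot_matrix: "dot a (M *v x) = dot (\<chi> j. \<Sum>i\<in>UNIV. a $ i * M $ i $ j) x"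
  unfolding dot_def matrix_vector_mult_def vec_lambda_beta sum_distrib_left sum_distrib_right
  by (subst sum.swap) (simp add: mult_ac)

lemma dot_eq_zero_multiple:
  assumes "a \<noteq> 0" "\<And>x. dot a x = 0 \<Longrightarrow> dot b x = 0"
  obtains c where "b = c *s a"
proof -
  obtain i where i: "a $ i \<noteq> 0" using assms(1) by (auto simp: vec_eq_iff)
  have "b $ j = b $ i / a $ i * a $ j" for j
  proof -
    have "dot a (a $ i *s axis j 1 - a $ j *s axis i 1) = 0"
      by (simp add: dot_diff_right dot_scale_right)
    from assms(2)[OF this] show ?thesis using i
      by (simp add: dot_diff_right dot_scale_right field_simps)
  qed
  then have "b = (b $ i / a $ i) *s a"
    unfolding vec_eq_iff vector_smult_component by blast
  then show ?thesis by (rule that)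
qed

lemma proj_pt_eqD:
  assumes "proj_pt v = proj_pt w" "v \<noteq> 0"
  obtains c where "c \<noteq> 0" "v = c *s w"
proof -
  have "v \<in> proj_pt v" by (simp add: proj_pt_def vec.span_base)
  then have "v \<in> proj_pt w" using assms(1) by simp
  then obtain c where "v = c *s w" by (auto simp: proj_pt_def vec.span_singleton)
  with assms(2) that[of c] show ?thesis by auto
qed

lemma proj_pt_scale:
  assumes "c \<noteq> 0"
  shows "proj_pt (c *s v) = proj_pt v"
proof -
  have "range (\<lambda>k. k *s (c *s v)) = range (\<lambda>k. k *s v)"
  proof (intro equalityI image_subsetI)
    fix k show "k *s (c *s v) \<in> range (\<lambda>k. k *s v)" by (rule range_eqI[of _ _ "k * c"]) simp
    show "k *s v \<in> range (\<lambda>k. k *s (c *s v))" by (rule range_eqI[of _ _ "k / c"]) (simp add: assms)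
  qed
  then show ?thesis by (simp add: proj_pt_def vec.span_singleton)
qed

lemma hyperplane_cone_proj_pt: "hyperplane_cone (proj_pt a) = {x. dot a x = 0}"
proof -
  have "(\<forall>b\<in>proj_pt a. dot b x = 0) \<longleftrightarrow> dot a x = 0" for x
    by (auto simp: proj_pt_def vec.span_singleton dot_scale_left dest: spec[of _ 1])
  then show ?thesis by (simp add: hyperplane_cone_def dot_def[symmetric])
qed

lemma hyperplane_cone_inj:
  assumes "H \<in> proj_space" "K \<in> proj_space" "hyperplane_cone H = hyperplane_cone K"
  shows "H = K"
proof -
  obtain a b where a: "H = proj_pt a" "a \<noteq> 0" and b: "K = proj_pt b" "b \<noteq> 0"
    using assms by (auto simp: proj_space_def)
  have "dot a x = 0 \<Longrightarrow> dot b x = 0" for x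
    using assms(3) by (auto simp: a b hyperplane_cone_proj_pt set_eq_iff)
  then obtain c where c: "b = c *s a" using dot_eq_zero_multiple[OF a(2)] by blast
  with b have "c \<noteq> 0" by auto
  then show ?thesis by (simp add: a b c proj_pt_scale)
qed

lemma coordinate_complement:
  fixes i :: "'n::finite"
  assumes "CARD('n) = Suc CARD('m::finite)"
  obtains \<iota> :: "'m::finite \<Rightarrow> 'n" where "bij_betw \<iota> UNIV (UNIV - {i})"
proof -
  have "card (UNIV - {i}) = CARD('m)" using assms by simp
  then show ?thesis using finite_same_card_bij[of "UNIV :: 'm set" "UNIV - {i}"] that by auto
qed

text \<open>Guarantees that the choice in \<open>local_equation\<close> yields a chart. The columns
  of \<open>M\<close> are the unit vectors other than the one for an index \<open>i\<close> with
  \<open>v $ i\<close> nonzero.\<close>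

lemma affine_chart_exists:
  fixes v :: "complex^'n::finite"
  assumes "v \<noteq> 0" "CARD('n) = Suc CARD('m::finite)"
  shows "\<exists>M :: complex^('m::finite)^'n. affine_chart (proj_pt v) v M"
proof -
  obtain i where i: "v $ i \<noteq> 0" using assms(1) by (auto simp: vec_eq_iff)
  obtain \<iota> :: "'m \<Rightarrow> 'n" where \<iota>: "bij_betw \<iota> UNIV (UNIV - {i})"
    using coordinate_complement[OF assms(2)] by blast
  have \<iota>i: "\<iota> c \<noteq> i" "i \<noteq> \<iota> c" for c using bij_betw_apply[OF \<iota>, of c] by auto
  have inj: "\<iota> c = \<iota> c' \<longleftrightarrow> c = c'" for c c' using \<iota> by (auto simp: bij_betw_def inj_on_def)
  have cases: "r = i \<or> (\<exists>c. r = \<iota> c)" for r using \<iota> by (auto simp: bij_betw_def image_iff set_eq_iff)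
  define M :: "complex^'m^'n" where "M = (\<chi> r c. if r = \<iota> c then 1 else 0)"
  have M1: "(M *v y) $ i = 0" for y
    using \<iota>i by (auto simp: M_def matrix_vector_mult_def if_distrib[of "\<lambda>x. x * _"] intro!: sum.neutral)
  have M2: "(M *v y) $ \<iota> c = y $ c" for y c
    by (simp add: M_def matrix_vector_mult_def inj if_distrib[of "\<lambda>x. x * _"] cong: if_cong)
  have "bij (\<lambda>(s, y). s *s v + M *v y)"
  proof (rule bijI)
    show "inj (\<lambda>(s, y). s *s v + M *v y)"
    proof (rule injI, clarify)
      fix s y s' y' assume e: "s *s v + M *v y = s' *s v + M *v y'"
      have "s * v $ i = s' * v $ i" using arg_cong[OF e, of "\<lambda>x. x $ i"] by (simp add: M1)
      with i have s: "s = s'" by simp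
      have "y $ c = y' $ c" for c using arg_cong[OF e, of "\<lambda>x. x $ \<iota> c"] by (simp add: M2 s)
      then show "s = s' \<and> y = y'" using s by (simp add: vec_eq_iff)
    qed
    show "surj (\<lambda>(s, y). s *s v + M *v y)"
    proof (rule surjI)
      fix x
      have "(x $ i / v $ i) *s v + M *v (\<chi> c. x $ \<iota> c - x $ i / v $ i * v $ \<iota> c) = x"
        unfolding vec_eq_iff
      proof
        fix r
        show "((x $ i / v $ i) *s v + M *v (\<chi> c. x $ \<iota> c - x $ i / v $ i * v $ \<iota> c)) $ r = x $ r"
          using cases[of r] i by (auto simp: M1 M2)
      qed
      then show "(\<lambda>(s, y). s *s v + M *v y) ((\<lambda>x. (x $ i / v $ i, \<chi> c. x $ \<iota> c - x $ i / v $ i * v $ \<iota> c)) x) = x"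
        by simp
    qed
  qed
  then show ?thesis by (auto simp: affine_chart_def)
qed

text \<open>Solving the equation for a coordinate with nonzero coefficient leaves the other three as
  parameters.\<close>

lemma plane_param_exists:
  assumes "H \<in> proj_space"
  shows "\<exists>M. plane_param H M"
proof -
  obtain a :: "complex^4" where a: "H = proj_pt a" "a \<noteq> 0" using assms by (auto simp: proj_space_def)
  obtain i where i: "a $ i \<noteq> 0" using a(2) by (auto simp: vec_eq_iff)
  obtain \<iota> :: "3 \<Rightarrow> 4" where \<iota>: "bij_betw \<iota> UNIV (UNIV - {i})"
    using coordinate_complement[where 'm = 3 and 'n = 4 and i = i] by auto
  have \<iota>i: "\<iota> c \<noteq> i" "i \<noteq> \<iota> c" for c using bij_betw_apply[OF \<iota>, of c] by auto
  have inj: "\<iota> c = \<iota> c' \<longleftrightarrow> c = c'" for c c' using \<iota> by (auto simp: bij_betw_def inj_on_def)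
  have cases: "r = i \<or> (\<exists>c. r = \<iota> c)" for r using \<iota> by (auto simp: bij_betw_def image_iff set_eq_iff)
  define M :: "complex^3^4" where "M = (\<chi> r c. if r = \<iota> c then 1 else if r = i then - a $ \<iota> c / a $ i else 0)"
  have M1: "(M *v y) $ i = - (\<Sum>c\<in>UNIV. a $ \<iota> c * y $ c) / a $ i" for y
    by (simp add: M_def matrix_vector_mult_def \<iota>i sum_divide_distrib sum_negf)
  have M2: "(M *v y) $ \<iota> c = y $ c" for y c
    by (simp add: M_def matrix_vector_mult_def inj \<iota>i if_distrib[of "\<lambda>x. x * _"] cong: if_cong)
  have dot: "dot a x = a $ i * x $ i + (\<Sum>c\<in>UNIV. a $ \<iota> c * x $ \<iota> c)" for x
    unfolding dot_def by (subst sum.remove[of _ i]) (simp_all add: sum.reindex_bij_betw[OF \<iota>, symmetric])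
  have "plane_param H M" unfolding plane_param_def a hyperplane_cone_proj_pt
  proof
    show "inj ((*v) M)" by (rule injI) (metis M2 vec_eq_iff)
    show "range ((*v) M) = {x. dot a x = 0}"
    proof safe
      fix y show "dot a (M *v y) = 0" using i by (simp add: dot M1 M2)
    next
      fix x assume "dot a x = 0"
      then have xi: "x $ i = - (\<Sum>c\<in>UNIV. a $ \<iota> c * x $ \<iota> c) / a $ i"
        using i by (simp add: dot field_simps add_eq_0_iff)
      have "x = M *v (\<chi> c. x $ \<iota> c)" unfolding vec_eq_iff
      proof
        fix r show "x $ r = (M *v (\<chi> c. x $ \<iota> c)) $ r"
          using cases[of r] xi by (auto simp: M1 M2)
      qed
      then show "x \<in> range ((*v) M)" by blast
    qed
  qed
  then show ?thesis ..
qed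

lemma plane_section_param:
  assumes "H \<in> proj_space"
  obtains M where "plane_param H M" "plane_section f H = linear_pullback M f"
  using someI_ex[OF plane_param_exists[OF assms]] that unfolding plane_section_def by blast

lemma matrix_eqI: "(\<And>y. A *v y = B *v y) \<Longrightarrow> A = (B :: complex^'n::finite^'m)"
  by (simp add: matrix_eq)

lemma matrix_factor:
  fixes M :: "complex^'k::finite^'n::finite" and N :: "complex^'m::finite^'n"
  assumes "range ((*v) N) \<subseteq> range ((*v) M)"
  obtains B where "N = M ** B"
proof -
  have "\<forall>j. \<exists>b. M *v b = N *v axis j 1" using assms by (metis rangeE rangeI subsetD)
  then obtain b where b: "\<And>j. M *v b j = N *v axis j 1" by metis
  have "N $ i $ j = (M ** (\<chi> i j. b j $ i)) $ i $ j" for i j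
    using arg_cong[OF b[of j], of "\<lambda>x. x $ i"]
    by (simp add: matrix_matrix_mult_def matrix_vector_nth) (simp add: dot_def)
  then have "N = M ** (\<chi> i j. b j $ i)" by (simp add: vec_eq_iff)
  then show ?thesis by (rule that)
qed

lemma plane_param_unique:
  assumes "plane_param H M" "plane_param H N"
  obtains A where "invertible A" "N = M ** A"
proof -
  have "range ((*v) N) \<subseteq> range ((*v) M)" "range ((*v) M) \<subseteq> range ((*v) N)"
    using assms by (simp_all add: plane_param_def)
  from matrix_factor[OF this(1)] matrix_factor[OF this(2)]
  obtain A B where A: "N = M ** A" and B: "M = N ** B" by metis
  have "A ** B = mat 1"
  proof (rule matrix_eqI)
    fix y
    have "M *v ((A ** B) *v y) = M *v y"
      by (metis A B matrix_mul_assoc matrix_vector_mul_assoc)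
    then show "(A ** B) *v y = mat 1 *v y"
      using assms(1) by (simp add: plane_param_def inj_def)
  qed
  then have "invertible A" using invertible_right_inverse by blast
  with A that show ?thesis by blast
qed

section \<open>Pullback of forms along matrices and Euler's identity\<close>

lemma mpoly_eqI_vec:
  fixes f g :: "'v::finite mpoly"
  assumes "\<And>y::complex^'v. eval (($) y) f = eval (($) y) g"
  shows "f = g"
proof (rule mpoly_eqI)
  fix x :: "'v \<Rightarrow> complex"
  have "($) (\<chi> i. x i) = x" by (simp add: fun_eq_iff)
  with assms[of "\<chi> i. x i"] show "eval x f = eval x g" by simp
qed

lemma eval_linear_pullback: "eval (($) y) (linear_pullback M f) = eval (($) (M *v y)) f"
  by (simp add: eval_affine_pullback)

lemma linear_pullback_compose:
  "linear_pullback A (linear_pullback M f) = linear_pullback (M ** A) f"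
  by (rule mpoly_eqI_vec) (simp add: eval_linear_pullback matrix_vector_mul_assoc)

lemma linear_pullback_mat_1 [simp]: "linear_pullback (mat 1) f = f"
  by (rule mpoly_eqI_vec) (simp add: eval_linear_pullback)

lemma linear_pullback_Const_mult: "linear_pullback A (Const c * f) = Const c * linear_pullback A f"
  by (rule mpoly_eqI_vec) (simp add: eval_linear_pullback eval_mult)

lemma eval_scale_vec: "homogeneous d f \<Longrightarrow> eval (($) (t *s x)) f = t ^ d * eval (($) x) f"
  using eval_scale_homogeneous[of d f t "($) x"]
  by (simp add: vector_scalar_mult_def vec_lambda_inverse)

lemma mat_mult_vec: "mat s *v y = s *s (y :: complex^'n::finite)"
  by (simp add: vec_eq_iff matrix_vector_mult_def mat_def if_distrib[of "\<lambda>x. x * _"] cong: if_cong)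

lemma invertible_mat: "s \<noteq> 0 \<Longrightarrow> invertible (mat s :: complex^'n::finite^'n)"
proof -
  assume "s \<noteq> 0"
  then have "mat s ** mat (1 / s) = (mat 1 :: complex^'n^'n)"
    by (intro matrix_eqI) (simp add: matrix_vector_mul_assoc[symmetric] mat_mult_vec)
  then show ?thesis using invertible_right_inverse by blast
qed

lemma linear_pullback_mat: "homogeneous d f \<Longrightarrow> linear_pullback (mat s) f = Const (s ^ d) * f"
  by (rule mpoly_eqI_vec) (simp add: eval_linear_pullback mat_mult_vec eval_scale_vec eval_mult)

lemma homogeneous_mult: "homogeneous a f \<Longrightarrow> homogeneous b g \<Longrightarrow> homogeneous (a + b) (f * g)"
  using keys_mult[of f g] by (fastforce simp: homogeneous_def mdeg_add)

lemma homogeneous_zero [simp]: "homogeneous a 0"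
  by (simp add: homogeneous_def)

lemma homogeneous_add: "homogeneous a f \<Longrightarrow> homogeneous a g \<Longrightarrow> homogeneous a (f + g)"
  using keys_add[of f g] by (fastforce simp: homogeneous_def)

lemma homogeneous_sum: "(\<And>i. i \<in> S \<Longrightarrow> homogeneous a (f i)) \<Longrightarrow> homogeneous a (sum f S)"
  by (induction S rule: infinite_finite_induct) (simp_all add: homogeneous_add)

lemma homogeneous_one [simp]: "homogeneous 0 1"
  by (simp add: homogeneous_def)

lemma homogeneous_power: "homogeneous a f \<Longrightarrow> homogeneous (a * k) (f ^ k)"
  by (induction k) (simp_all add: homogeneous_mult)

lemma homogeneous_prod: "(\<And>i. i \<in> S \<Longrightarrow> homogeneous (a i) (f i)) \<Longrightarrow> homogeneous (sum a S) (prod f S)"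
  by (induction S rule: infinite_finite_induct) (simp_all add: homogeneous_mult)

lemma homogeneous_Const: "homogeneous 0 (Const c)"
  by (simp add: homogeneous_def Const_def)

lemma homogeneous_Var: "homogeneous 1 (Var i)"
  by (simp add: homogeneous_def Var_def)

lemma homogeneous_linear_form: "homogeneous 1 (linear_form a)"
  unfolding linear_form_def
  using homogeneous_mult[OF homogeneous_Const homogeneous_Var] by (intro homogeneous_sum) simp

lemma homogeneous_linear_pullback:
  assumes "homogeneous d f"
  shows "homogeneous d (linear_pullback M f)"
proof -
  have "homogeneous (0 + (\<Sum>i\<in>Poly_Mapping.keys m. 1 * Poly_Mapping.lookup m i))
     (Const (Poly_Mapping.lookup f m) * (\<Prod>i\<in>Poly_Mapping.keys m. (Const (0 $ i) + linear_form (M $ i)) ^ Poly_Mapping.lookup m i))"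
    for m
    using homogeneous_linear_form
    by (intro homogeneous_mult homogeneous_prod homogeneous_power homogeneous_Const)
       (simp add: Const_def)
  then show ?thesis
    using assms unfolding affine_pullback_def mp_eval_def
    by (intro homogeneous_sum) (auto simp: homogeneous_def[of _ f] mdeg_def)
qed

definition dir_deriv :: "'v::finite mpoly \<Rightarrow> complex^'v \<Rightarrow> complex^'v \<Rightarrow> complex" where
  "dir_deriv f x w = (\<Sum>i\<in>UNIV. eval (($) x) (pderiv_mp i f) * w $ i)"

lemma has_derivative_dir_deriv: "((\<lambda>x. eval (($) x) f) has_derivative dir_deriv f x) (at x)"
  using has_derivative_eval unfolding dir_deriv_def .

lemma dir_deriv_add: "dir_deriv f x (v + w) = dir_deriv f x v + dir_deriv f x w"
  by (simp add: dir_deriv_def distrib_left sum.distrib)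

lemma dir_deriv_scale: "dir_deriv f x (c *s v) = c * dir_deriv f x v"
  by (simp add: dir_deriv_def sum_distrib_left mult_ac)

lemma dir_deriv_zero [simp]: "dir_deriv f x 0 = 0"
  by (simp add: dir_deriv_def)

lemma dir_deriv_axis [simp]: "dir_deriv f x (axis i 1) = eval (($) x) (pderiv_mp i f)"
  by (simp add: dir_deriv_def axis_def if_distrib cong: if_cong)

lemma dir_deriv_affine_pullback:
  "dir_deriv (affine_pullback v M f) y z = dir_deriv f (v + M *v y) (M *v z)"
proof -
  have bl: "bounded_linear ((*v) M)" using matrix_vector_mul_bounded_linear[of M] .
  have "((\<lambda>y. eval (($) (v + M *v y)) f) has_derivative (\<lambda>z. dir_deriv f (v + M *v y) (M *v z))) (at y)"
    by (rule has_derivative_compose[OF _ has_derivative_dir_deriv])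
       (auto intro!: derivative_eq_intros bounded_linear_imp_has_derivative bl)
  then have "((\<lambda>y. eval (($) y) (affine_pullback v M f)) has_derivative (\<lambda>z. dir_deriv f (v + M *v y) (M *v z))) (at y)"
    by (simp add: eval_affine_pullback)
  from has_derivative_unique[OF this has_derivative_dir_deriv] show ?thesis by metis
qed

lemma homogeneous_pderiv:
  assumes "homogeneous d f"
  shows "homogeneous (d - 1) (pderiv_mp i f)"
  unfolding homogeneous_def
proof
  fix m assume "m \<in> Poly_Mapping.keys (pderiv_mp i f)"
  then have "m + Poly_Mapping.single i 1 \<in> Poly_Mapping.keys f"
    by (simp add: in_keys_iff lookup_pderiv)
  then show "mdeg m = d - 1" using assms by (fastforce simp: homogeneous_def mdeg_add)
qed

lemma euler_identity:
  assumes "homogeneous d f"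
  shows "dir_deriv f x x = of_nat d * eval (($) x) f"
proof -
  have m: "of_nat (Poly_Mapping.lookup m i) * mon (($) x) (m - Poly_Mapping.single i 1) * x $ i
      = of_nat (Poly_Mapping.lookup m i) * mon (($) x) m" for m i
  proof (cases "Poly_Mapping.lookup m i = 0")
    case False
    then have "m = (m - Poly_Mapping.single i 1) + Poly_Mapping.single i 1"
      by (auto intro!: poly_mapping_eqI simp: lookup_add lookup_minus lookup_single when_def)
    then have "mon (($) x) m = mon (($) x) (m - Poly_Mapping.single i 1) * x $ i"
      by (metis mon_add mon_single power_one_right)
    then show ?thesis by simp
  qed simp
  have "dir_deriv f x x = (\<Sum>i\<in>UNIV. \<Sum>m\<in>Poly_Mapping.keys f. Poly_Mapping.lookup f m *
      (of_nat (Poly_Mapping.lookup m i) * mon (($) x) (m - Poly_Mapping.single i 1) * x $ i))"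
    by (simp add: dir_deriv_def eval_pderiv sum_distrib_left sum_distrib_right mult_ac)
  also have "\<dots> = (\<Sum>m\<in>Poly_Mapping.keys f. Poly_Mapping.lookup f m * mon (($) x) m * of_nat (mdeg m))"
    unfolding m
    by (subst sum.swap) (simp add: mdeg_superset[of UNIV] sum_distrib_left mult_ac)
  also have "\<dots> = of_nat d * eval (($) x) f"
    using assms by (simp add: eval_mon homogeneous_def sum_distrib_left mult_ac cong: sum.cong)
  finally show ?thesis .
qed

subsection \<open>Linear syzygies of a nodal plane curve\<close>

lemma dir_deriv_eqI:
  assumes "((\<lambda>x. eval (($) x) f) has_derivative D) (at x)"
  shows "dir_deriv f x = D"
  using has_derivative_unique[OF has_derivative_dir_deriv assms] .

lemma bounded_linear_dot: "bounded_linear (dot a)"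
  unfolding dot_def
  by (intro bounded_linear_sum bounded_linear_mult_right[THEN bounded_linear_compose] bounded_linear_vec_nth)

lemma eval_linear_form_dot: "eval (($) y) (linear_form a) = dot a y"
  by (simp add: eval_linear_form dot_def)

lemma dir_deriv_linear_form_mult:
  "dir_deriv (linear_form a * linear_form b) y z = dot a y * dot b z + dot a z * dot b y"
proof -
  have d: "(dot c has_derivative dot c) (at y)" for c
    by (rule bounded_linear_imp_has_derivative[OF bounded_linear_dot])
  have "((\<lambda>y. eval (($) y) (linear_form a * linear_form b)) has_derivative
      (\<lambda>z. dot a y * dot b z + dot a z * dot b y)) (at y)"
    unfolding eval_mult eval_linear_form_dot by (rule has_derivative_mult[OF d d])
  from dir_deriv_eqI[OF this] show ?thesis by simp
qed

lemma dir_deriv_minus: "dir_deriv (f - g) x w = dir_deriv f x w - dir_deriv g x w"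
proof -
  have "((\<lambda>x. eval (($) x) (f - g)) has_derivative (\<lambda>w. dir_deriv f x w - dir_deriv g x w)) (at x)"
    unfolding eval_minus by (rule has_derivative_diff[OF has_derivative_dir_deriv has_derivative_dir_deriv])
  from dir_deriv_eqI[OF this] show ?thesis by simp
qed

text \<open>Along the ray through \<open>y\<close> a monomial of degree \<open>n\<close> scales by
  \<open>t ^ n\<close>. The quotient by \<open>t ^ k\<close> is kept as a polynomial in
  \<open>t\<close>, so that the coefficients of an expansion can be compared.\<close>

lemma eval_vanishing_order:
  assumes "\<And>m. mdeg m < k \<Longrightarrow> Poly_Mapping.lookup r m = 0"
  obtains p :: "complex poly" where "\<And>t. eval (($) (t *s y)) r = t ^ k * poly p t"
proof
  fix t
  have s: "($) (t *s y) = (\<lambda>i. t * y $ i)" by (simp add: fun_eq_iff)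
  have "t ^ mdeg m = t ^ k * t ^ (mdeg m - k)" if "m \<in> Poly_Mapping.keys r" for m
  proof -
    have "k \<le> mdeg m" using assms[of m] that by (auto simp: in_keys_iff not_less[symmetric])
    then show ?thesis by (simp add: power_add[symmetric])
  qed
  then show "eval (($) (t *s y)) r = t ^ k * poly (\<Sum>m\<in>Poly_Mapping.keys r.
      Polynomial.monom (Poly_Mapping.lookup r m * mon (($) y) m) (mdeg m - k)) t"
    by (simp add: s eval_mon mon_scale poly_sum poly_monom sum_distrib_left mult_ac cong: sum.cong)
qed

lemma dir_deriv_vanishing_order:
  assumes "\<And>m. mdeg m < Suc k \<Longrightarrow> Poly_Mapping.lookup r m = 0"
  obtains p :: "complex poly" where "\<And>t. dir_deriv r (t *s y) z = t ^ k * poly p t"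
proof -
  have "\<exists>p. \<forall>t. eval (($) (t *s y)) (pderiv_mp i r) = t ^ k * poly p t" for i
  proof -
    have "Poly_Mapping.lookup (pderiv_mp i r) m = 0" if "mdeg m < k" for m
      using assms[of "m + Poly_Mapping.single i 1"] that by (simp add: lookup_pderiv mdeg_add)
    then show ?thesis by (rule eval_vanishing_order[of k "pderiv_mp i r" y]) blast+
  qed
  then obtain p where p: "\<And>i t. eval (($) (t *s y)) (pderiv_mp i r) = t ^ k * poly (p i) t" by metis
  show ?thesis
    by (rule that[of "\<Sum>i\<in>UNIV. Polynomial.smult (z $ i) (p i)"])
       (simp add: dir_deriv_def p poly_sum sum_distrib_left mult_ac)
qed

text \<open>The power of \<open>t\<close> is cancelled in the polynomial ring, since it may vanish
  at \<open>t = 0\<close>, where the other factor has to be evaluated.\<close>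

lemma lowest_coeff_zero:
  fixes A :: complex
  assumes "\<And>t. t ^ k * (A + t * poly p t) = 0"
  shows "A = 0"
proof -
  have "poly (Polynomial.monom 1 k * ([:A:] + [:0, 1:] * p)) t = 0" for t
  proof -
    have "poly (Polynomial.monom 1 k * ([:A:] + [:0, 1:] * p)) t = t ^ k * (A + t * poly p t)"
      by (simp add: poly_monom algebra_simps)
    with assms[of t] show ?thesis by simp
  qed
  then have "Polynomial.monom 1 k * ([:A:] + [:0, 1:] * p) = 0" using poly_all_0_iff_0 by blast
  then have "[:A:] + [:0, 1:] * p = 0" by (simp only: mult_eq_0_iff monom_eq_0_iff) simp
  then have "poly ([:A:] + [:0, 1:] * p) 0 = 0" by simp
  then show ?thesis by simp
qed

text \<open>For a node with quadratic part \<open>a b\<close> the vectors \<open>e\<close> and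
  \<open>f\<close> span the two tangent lines: \<open>e\<close> the line \<open>b = 0\<close>, and
  \<open>f\<close> the line \<open>a = 0\<close>.\<close>

lemma dual_basis_2:
  fixes a b :: "complex^2"
  assumes "a \<noteq> 0" "b \<noteq> 0" "proj_pt a \<noteq> proj_pt b"
  obtains e f where "dot a e = 1" "dot b e = 0" "dot a f = 0" "dot b f = 1"
    "\<And>y. y = dot a y *s e + dot b y *s f"
proof -
  have *: "\<exists>f. dot a f = 0 \<and> dot b f = 1" if ab: "a \<noteq> 0" "b \<noteq> 0" "proj_pt a \<noteq> proj_pt b" for a b :: "complex^2"
  proof -
    have "\<exists>x. dot a x = 0 \<and> dot b x \<noteq> 0"
    proof (rule ccontr)
      assume "\<not> ?thesis"
      then have "\<And>x. dot a x = 0 \<Longrightarrow> dot b x = 0" by blast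
      from dot_eq_zero_multiple[OF ab(1) this] obtain c where c: "b = c *s a" by blast
      with ab(2) have "c \<noteq> 0" by auto
      with c ab(3) show False by (simp add: proj_pt_scale)
    qed
    then obtain x where "dot a x = 0" "dot b x \<noteq> 0" by blast
    then show ?thesis by (intro exI[of _ "(1 / dot b x) *s x"]) (simp add: dot_scale_right)
  qed
  obtain f where f: "dot a f = 0" "dot b f = 1" using *[OF assms] by blast
  obtain e where e: "dot b e = 0" "dot a e = 1" using *[OF assms(2,1) assms(3)[symmetric]] by blast
  have ker: "y = 0" if "dot a y = 0" "dot b y = 0" for y
  proof -
    \<comment> \<open>The determinant of the rows \<open>a\<close>, \<open>b\<close> times that of
      the columns \<open>e\<close>, \<open>f\<close>; the product of the two matrices is the
      identity.\<close>
    have D: "(a $ 1 * b $ 2 - a $ 2 * b $ 1) * (e $ 1 * f $ 2 - e $ 2 * f $ 1) = 1"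
    proof -
      have "(a $ 1 * b $ 2 - a $ 2 * b $ 1) * (e $ 1 * f $ 2 - e $ 2 * f $ 1) = dot a e * dot b f - dot a f * dot b e"
        by (simp add: dot_def sum_2 algebra_simps)
      with e f show ?thesis by simp
    qed
    have "y $ 1 * (a $ 1 * b $ 2 - a $ 2 * b $ 1) = 0" "y $ 2 * (a $ 1 * b $ 2 - a $ 2 * b $ 1) = 0"
    proof -
      have "y $ 1 * (a $ 1 * b $ 2 - a $ 2 * b $ 1) = b $ 2 * dot a y - a $ 2 * dot b y"
        "y $ 2 * (a $ 1 * b $ 2 - a $ 2 * b $ 1) = a $ 1 * dot b y - b $ 1 * dot a y"
        by (simp_all add: dot_def sum_2 algebra_simps)
      with that show "y $ 1 * (a $ 1 * b $ 2 - a $ 2 * b $ 1) = 0" "y $ 2 * (a $ 1 * b $ 2 - a $ 2 * b $ 1) = 0"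
        by simp_all
    qed
    with D have "y $ 1 = 0" "y $ 2 = 0" by auto
    then show ?thesis by (simp add: vec_eq_iff forall_2)
  qed
  have "y = dot a y *s e + dot b y *s f" for y
    using ker[of "y - (dot a y *s e + dot b y *s f)"] e f
    by (simp add: dot_diff_right dot_add_right dot_scale_right)
  with e f that show ?thesis by blast
qed

text \<open>In the basis \<open>w1\<close>, \<open>w2\<close>, \<open>w3\<close>, which forms the
  columns of \<open>S\<close>, the map \<open>B\<close> has the matrix \<open>T\<close> with
  diagonal \<beta>, \<alpha>, \<gamma>, and conjugation preserves the trace.\<close>

lemma trace_from_basis_3:
  fixes B :: "complex^3^3"
  assumes ind: "\<And>x y z. x *s w1 + y *s w2 + z *s w3 = 0 \<Longrightarrow> x = 0 \<and> y = 0 \<and> z = 0"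
    and B: "B *v w1 = \<beta> *s w1" "B *v w2 = l1 *s w1 + \<alpha> *s w2" "B *v w3 = l2 *s w1 + \<gamma> *s w3"
  shows "trace B = \<beta> + \<alpha> + \<gamma>"
proof -
  define S :: "complex^3^3" where "S = (\<chi> i j. vector [w1 $ i, w2 $ i, w3 $ i] $ j)"
  define T :: "complex^3^3" where "T = vector [vector [\<beta>, l1, l2], vector [0, \<alpha>, 0], vector [0, 0, \<gamma>]]"
  have S: "S *v y = y $ 1 *s w1 + y $ 2 *s w2 + y $ 3 *s w3" for y
    by (simp add: S_def vec_eq_iff matrix_vector_mult_def sum_3 mult.commute)
  have "inj ((*v) S)"
  proof (rule injI)
    fix x y assume "S *v x = S *v y"
    then have "S *v (x - y) = 0" by (simp add: matrix_vector_mult_diff_distrib)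
    then show "x = y" using ind[of "(x - y) $ 1" "(x - y) $ 2" "(x - y) $ 3"]
      by (simp only: S) (simp add: vec_eq_iff forall_3)
  qed
  then obtain S' where S': "S' ** S = mat 1" using matrix_left_invertible_injective by blast
  then have S'': "S ** S' = mat 1" using matrix_left_right_inverse by blast
  have BS: "B ** S = S ** T"
  proof (rule matrix_eqI)
    fix y
    have T: "(T *v y) $ 1 = \<beta> * y $ 1 + l1 * y $ 2 + l2 * y $ 3" "(T *v y) $ 2 = \<alpha> * y $ 2" "(T *v y) $ 3 = \<gamma> * y $ 3"
      by (simp_all add: T_def matrix_vector_mult_def sum_3)
    have "B *v (S *v y) = S *v (T *v y)"
      unfolding S T
      by (simp add: matrix_vector_right_distrib vector_scalar_commute
          B vec_eq_iff algebra_simps)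
    then show "(B ** S) *v y = (S ** T) *v y" by (simp add: matrix_vector_mul_assoc)
  qed
  have "trace B = trace (B ** S ** S')" by (metis S'' matrix_mul_assoc matrix_mul_rid)
  also have "\<dots> = trace (S' ** (S ** T))" by (metis BS trace_mul_sym)
  also have "\<dots> = trace T" by (simp add: matrix_mul_assoc S')
  also have "\<dots> = \<beta> + \<alpha> + \<gamma>" by (simp add: trace_def T_def sum_3)
  finally show ?thesis .
qed

text \<open>
  In a chart at the node, \<open>g = q + O(3)\<close> with \<open>q\<close> a nondegenerate quadratic form.  The terms of
  order one in the syzygy show that the line of \<open>v\<close> is invariant under \<open>B\<close>; those of order two
  show that the map induced by \<open>B\<close> on the tangent plane preserves both branch directions and has
  trace \<open>- (d - 2) \<beta>\<close>.
\<close>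

lemma node_eigenvalue:
  fixes g :: "3 mpoly" and B :: "complex^3^3"
  assumes hom: "homogeneous d g" and v: "v \<noteq> 0" and node: "is_node g (proj_pt v)"
    and syz: "\<And>x. dir_deriv g x (B *v x) = 0"
  shows "\<exists>\<beta>. B *v v = \<beta> *s v \<and> (of_nat d - 3) * \<beta> = - trace B"
proof -
  obtain M1 :: "complex^2^3" where "affine_chart (proj_pt v) v M1"
    using affine_chart_exists[OF v, where 'm=2] by auto
  then have ex: "\<exists>c. case c of (w, M) \<Rightarrow> affine_chart (proj_pt v) w (M :: complex^2^3)" by auto
  \<comment> \<open>The chart is unspecified, so nothing but \<open>affine_chart\<close> is known
    about it; in particular \<open>w\<close> may differ from \<open>v\<close> by a scalar.\<close>
  obtain w and M :: "complex^2^3" where chart: "affine_chart (proj_pt v) w M"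
    and loc: "local_equation g (proj_pt v) = affine_pullback w M g"
    using someI_ex[OF ex] unfolding local_equation_def Let_def by (auto split: prod.splits)
  define h where "h = affine_pullback w M g"
  have bij: "bij (\<lambda>(s, y). s *s w + M *v y)" and pw: "proj_pt v = proj_pt w"
    using chart by (simp_all add: affine_chart_def)
  have dec: "\<exists>s y. x = s *s w + M *v y" for x
    using bij_is_surj[OF bij] by (metis (mono_tags, lifting) case_prod_unfold surjD)
  have ker: "s = 0 \<and> y = 0" if "s *s w + M *v y = 0" for s y
    using bij_is_inj[OF bij] that injD[of "\<lambda>(s, y). s *s w + M *v y" "(s, y)" "(0, 0)"] by auto
  obtain a b where ab: "a \<noteq> 0" "b \<noteq> 0" "proj_pt a \<noteq> proj_pt b"
    and h2: "\<And>m. mdeg m = 2 \<Longrightarrow> Poly_Mapping.lookup h m = Poly_Mapping.lookup (linear_form a * linear_form b) m"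
    and h1: "\<And>m. mdeg m < 2 \<Longrightarrow> Poly_Mapping.lookup h m = 0"
    using node unfolding is_node_def node_at_origin_def loc h_def by blast
  obtain e f where ef: "dot a e = 1" "dot b e = 0" "dot a f = 0" "dot b f = 1"
    and basis: "\<And>y. y = dot a y *s e + dot b y *s f"
    using dual_basis_2[OF ab] by blast
  define r where "r = h - linear_form a * linear_form b"
  have homq: "homogeneous 2 (linear_form a * linear_form b)"
    using homogeneous_mult[OF homogeneous_linear_form[of a] homogeneous_linear_form[of b]] by (simp add: numeral_2_eq_2)
  have r: "Poly_Mapping.lookup r m = 0" if "mdeg m < 3" for m
  proof (cases "mdeg m = 2")
    case False
    then have "Poly_Mapping.lookup (linear_form a * linear_form b) m = 0"
      using homq by (auto simp: homogeneous_def in_keys_iff)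
    with False that show ?thesis by (simp add: r_def lookup_minus h1)
  qed (simp add: r_def lookup_minus h2)
  have h_eval: "eval (($) y) h = dot a y * dot b y + eval (($) y) r" for y
    by (simp add: r_def eval_minus eval_mult eval_linear_form_dot)
  have h_deriv: "dir_deriv h y z = dot a y * dot b z + dot a z * dot b y + dir_deriv r y z" for y z
    by (simp add: r_def dir_deriv_minus dir_deriv_linear_form_mult)
  have g_eval: "eval (($) (w + M *v y)) g = eval (($) y) h" for y
    by (simp add: h_def eval_affine_pullback)
  have g_deriv: "dir_deriv g (w + M *v y) (M *v z) = dir_deriv h y z" for y z
    by (simp add: h_def dir_deriv_affine_pullback)
  \<comment> \<open>Euler's identity expresses the derivative in the direction \<open>w\<close>,
    which leaves the chart, through \<open>h\<close>. The syzygy thus becomes a relation for the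
    local equation alone.\<close>
  have g_deriv_w: "dir_deriv g (w + M *v y) w = of_nat d * eval (($) y) h - dir_deriv h y y" for y
    using euler_identity[OF hom, of "w + M *v y"]
    by (simp add: dir_deriv_add g_eval g_deriv algebra_simps)
  obtain \<beta> u where Bw: "B *v w = \<beta> *s w + M *v u" using dec by blast
  \<comment> \<open>The syzygy along the ray \<open>w + t M y\<close>, with the values of
    \<open>B\<close> split into a part along \<open>w\<close> and a part along the chart.\<close>
  have expand: "(\<beta> + t * l) * (of_nat d * eval (($) (t *s y)) h - dir_deriv h (t *s y) (t *s y))
      + dir_deriv h (t *s y) u + t * dir_deriv h (t *s y) c = 0"
    if "B *v (M *v y) = l *s w + M *v c" for t y l c
  proof -
    have "B *v (w + M *v (t *s y)) = (\<beta> + t * l) *s w + M *v u + t *s (M *v c)"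
      by (simp add: matrix_vector_right_distrib vector_scalar_commute Bw that vec_eq_iff algebra_simps)
    then show ?thesis
      using syz[of "w + M *v (t *s y)"]
      by (simp only: dir_deriv_add dir_deriv_scale g_deriv g_deriv_w)
  qed
  have order1: "dot a y * dot b u + dot a u * dot b y = 0" for y
  proof -
    obtain l c where c: "B *v (M *v y) = l *s w + M *v c" using dec by blast
    obtain p0 where p0: "\<And>t. eval (($) (t *s y)) r = t ^ 3 * poly p0 t"
      using eval_vanishing_order[of 3 r y] r by blast
    have "\<exists>p. \<forall>t. dir_deriv r (t *s y) z = t ^ 2 * poly p t" for z
      using dir_deriv_vanishing_order[of 2 r y z] r by (metis eval_nat_numeral(3))
    then obtain p where p: "\<And>z t. dir_deriv r (t *s y) z = t ^ 2 * poly (p z) t" by metis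
    show ?thesis
    \<comment> \<open>The witness is the part of \<open>expand\<close> beyond order one, with
      \<open>h = a b + r\<close> inserted. Only the derivative of \<open>h\<close> along
      \<open>u\<close> reaches order one.\<close>
    proof (rule lowest_coeff_zero[where k = 1 and p = "[:\<beta>, l:] * (Polynomial.smult ((of_nat d - 2) * dot a y * dot b y) 1
        + [:0, 1:] * (Polynomial.smult (of_nat d) p0 - p y)) + p u
        + [:dot a y * dot b c + dot a c * dot b y:] + [:0, 1:] * p c"])
      fix t
      show "t ^ 1 * (dot a y * dot b u + dot a u * dot b y + t * poly ([:\<beta>, l:] * (Polynomial.smult ((of_nat d - 2) * dot a y * dot b y) 1
        + [:0, 1:] * (Polynomial.smult (of_nat d) p0 - p y)) + p u
        + [:dot a y * dot b c + dot a c * dot b y:] + [:0, 1:] * p c) t) = 0"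
        using expand[OF c, of t]
        by (simp add: h_eval h_deriv p0 p dir_deriv_scale dot_scale_right power2_eq_square power3_eq_cube algebra_simps)
    qed
  qed
  have "dot a u = 0" "dot b u = 0" using order1[of e] order1[of f] by (simp_all add: ef)
  then have u: "u = 0" using basis[of u] by simp
  have order2: "(of_nat d - 2) * \<beta> * (dot a y * dot b y) + (dot a y * dot b c + dot a c * dot b y) = 0"
    if c: "B *v (M *v y) = l *s w + M *v c" for y l c
  proof -
    obtain p0 where p0: "\<And>t. eval (($) (t *s y)) r = t ^ 3 * poly p0 t"
      using eval_vanishing_order[of 3 r y] r by blast
    have "\<exists>p. \<forall>t. dir_deriv r (t *s y) z = t ^ 2 * poly p t" for z
      using dir_deriv_vanishing_order[of 2 r y z] r by (metis eval_nat_numeral(3))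
    then obtain p where p: "\<And>z t. dir_deriv r (t *s y) z = t ^ 2 * poly (p z) t" by metis
    show ?thesis
    \<comment> \<open>The factor \<open>d - 2\<close> is \<open>d\<close> from Euler's identity
      minus 2 from the derivative of the quadratic part along the ray.\<close>
    proof (rule lowest_coeff_zero[where k = 2 and p = "[:l * (of_nat d - 2) * dot a y * dot b y:]
        + [:\<beta>, l:] * (Polynomial.smult (of_nat d) p0 - p y) + p c"])
      fix t
      show "t ^ 2 * ((of_nat d - 2) * \<beta> * (dot a y * dot b y) + (dot a y * dot b c + dot a c * dot b y)
        + t * poly ([:l * (of_nat d - 2) * dot a y * dot b y:]
        + [:\<beta>, l:] * (Polynomial.smult (of_nat d) p0 - p y) + p c) t) = 0"
        using expand[OF c, of t]
        by (simp add: u h_eval h_deriv p0 p dir_deriv_scale dot_scale_right power2_eq_square power3_eq_cube algebra_simps)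
    qed
  qed
  obtain le ce where ce: "B *v (M *v e) = le *s w + M *v ce" using dec by blast
  obtain lf cf where cf: "B *v (M *v f) = lf *s w + M *v cf" using dec by blast
  \<comment> \<open>The quadratic part vanishes at \<open>e\<close> and at \<open>f\<close>, so
    there order two says that \<open>ce\<close> is a multiple of \<open>e\<close> and
    \<open>cf\<close> one of \<open>f\<close>. At \<open>e + f\<close> it equals 1, and order two
    yields the trace on the tangent plane.\<close>
  have "B *v (M *v (e + f)) = (le + lf) *s w + M *v (ce + cf)"
    by (simp add: matrix_vector_right_distrib ce cf vec_eq_iff algebra_simps)
  from order2[OF this] order2[OF ce] order2[OF cf]
  have s: "(of_nat d - 2) * \<beta> + (dot a ce + dot b cf) = 0" and ce0: "dot b ce = 0" and cf0: "dot a cf = 0"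
    by (simp_all add: ef dot_add_right add.commute)
  have "trace B = \<beta> + dot a ce + dot b cf"
  proof (rule trace_from_basis_3)
    show "B *v w = \<beta> *s w" using Bw u by simp
    have "M *v ce = dot a ce *s (M *v e)" using basis[of ce] ce0
      by (metis add.right_neutral vector_scalar_commute vector_smult_lzero)
    then show "B *v (M *v e) = le *s w + dot a ce *s (M *v e)" using ce by simp
    have "M *v cf = dot b cf *s (M *v f)" using basis[of cf] cf0
      by (metis add.left_neutral vector_scalar_commute vector_smult_lzero)
    then show "B *v (M *v f) = lf *s w + dot b cf *s (M *v f)" using cf by simp
    fix x y z assume "x *s w + y *s (M *v e) + z *s (M *v f) = 0"
    then have "x *s w + M *v (y *s e + z *s f) = 0"
      by (simp add: matrix_vector_right_distrib vector_scalar_commute add.assoc)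
    then have "x = 0" and yz: "y *s e + z *s f = 0" using ker by blast+
    have "dot a (y *s e + z *s f) = y" "dot b (y *s e + z *s f) = z"
      by (simp_all add: dot_add_right dot_scale_right ef)
    moreover have "dot a (y *s e + z *s f) = 0" "dot b (y *s e + z *s f) = 0" by (simp_all only: yz dot_zero)
    ultimately show "x = 0 \<and> y = 0 \<and> z = 0" using \<open>x = 0\<close> by simp
  qed
  with s have tr: "(of_nat d - 3) * \<beta> = - trace B" by (simp add: algebra_simps eq_neg_iff_add_eq_0)
  obtain c where "v = c *s w" using proj_pt_eqD[OF pw v] by blast
  then have "B *v v = \<beta> *s v" using Bw u by (simp add: vector_scalar_commute mult.commute)
  with tr show ?thesis by blast
qed

text \<open>A nonzero \<rho> would be the equation of a line through the points. In this form
  noncollinearity applies to linear forms, such as the rows of a matrix, without a choice of three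
  points.\<close>

lemma noncollinear_functional_zero:
  assumes "\<not> collinear_pts S" "S \<subseteq> proj_space"
    and "\<And>v. v \<noteq> 0 \<Longrightarrow> proj_pt v \<in> S \<Longrightarrow> dot \<rho> v = 0"
  shows "\<rho> = 0"
proof (rule ccontr)
  assume "\<rho> \<noteq> 0"
  then have "proj_pt \<rho> \<in> proj_space" by (auto simp: proj_space_def)
  moreover have "S \<subseteq> hyperplane (proj_pt \<rho>)"
    using assms(2,3) by (fastforce simp: hyperplane_def hyperplane_cone_proj_pt proj_space_def)
  ultimately show False using assms(1) by (auto simp: collinear_pts_def)
qed

lemma Sing_subset: "Sing g \<subseteq> proj_space"
  by (auto simp: Sing_def proj_space_def)

lemma no_linear_syzygy:
  fixes g :: "3 mpoly" and B :: "complex^3^3"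
  assumes d: "d \<ge> 4" and hom: "homogeneous d g"
    and nodes: "\<And>p. p \<in> Sing g \<Longrightarrow> is_node g p" and nc: "\<not> collinear_pts (Sing g)"
    and syz: "\<And>x. dir_deriv g x (B *v x) = 0"
  shows "B = 0"
proof -
  have "(of_nat d - 3 :: complex) = of_nat (d - 3)" using d by (simp add: of_nat_diff)
  then have d3: "(of_nat d - 3 :: complex) \<noteq> 0" using d by (simp del: of_nat_diff)
  define \<beta> where "\<beta> = - trace B / (of_nat d - 3)"
  have "B $ i - \<beta> *s axis i 1 = 0" for i
  proof (rule noncollinear_functional_zero[OF nc Sing_subset])
    fix v :: "complex^3" assume v: "v \<noteq> 0" "proj_pt v \<in> Sing g"
    obtain b where b: "B *v v = b *s v" "(of_nat d - 3) * b = - trace B"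
      using node_eigenvalue[OF hom v(1) nodes[OF v(2)] syz] by blast
    then have "b = \<beta>" using d3 by (simp add: \<beta>_def field_simps)
    then have "dot (B $ i) v = \<beta> * v $ i" using arg_cong[OF b(1), of "\<lambda>x. x $ i"] by (simp add: matrix_vector_nth)
    then show "dot (B $ i - \<beta> *s axis i 1) v = 0"
      by (simp add: dot_def left_diff_distrib sum_subtractf axis_def if_distrib[of "\<lambda>x. _ * x"] if_distrib[of "\<lambda>x. x * _"] cong: if_cong)
  qed
  then have B: "B $ i = \<beta> *s axis i 1" for i by (metis right_minus_eq)
  have "trace B = 3 * \<beta>" by (simp add: trace_def B axis_def sum_3)
  then have "of_nat d * \<beta> = 0" using d3 by (simp add: \<beta>_def field_simps)
  then have "\<beta> = 0" using d by simp
  then show ?thesis using B by (simp add: vec_eq_iff)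
qed

subsection \<open>The differential of the section map\<close>

lemma Sing_iff:
  assumes hom: "homogeneous d g" and v: "v \<noteq> 0"
  shows "proj_pt v \<in> Sing g \<longleftrightarrow> eval (($) v) g = 0 \<and> (\<forall>i. eval (($) v) (pderiv_mp i g) = 0)"
proof
  assume "proj_pt v \<in> Sing g"
  then obtain w where w: "proj_pt v = proj_pt w" "eval (($) w) g = 0" "\<forall>i. eval (($) w) (pderiv_mp i g) = 0"
    by (auto simp: Sing_def)
  obtain c where "v = c *s w" using proj_pt_eqD[OF w(1) v] by blast
  with w show "eval (($) v) g = 0 \<and> (\<forall>i. eval (($) v) (pderiv_mp i g) = 0)"
    by (simp add: eval_scale_vec[OF hom] eval_scale_vec[OF homogeneous_pderiv[OF hom]])
qed (use v in \<open>auto simp: Sing_def\<close>)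

lemma dir_deriv_linear_pullback: "dir_deriv (linear_pullback M f) y z = dir_deriv f (M *v y) (M *v z)"
  by (simp add: dir_deriv_affine_pullback)

lemma dir_deriv_dot: "dir_deriv f x w = dot (\<chi> i. eval (($) x) (pderiv_mp i f)) w"
  by (simp add: dir_deriv_def dot_def)

text \<open>By the chain rule the gradient of \<open>f\<close> at the point kills the range of
  \<open>M\<close>, which is the kernel of \<open>a\<close>. So either the plane is tangent to the
  surface there, or \<open>c = 0\<close> and the surface itself is singular.\<close>

lemma singular_point_pullback:
  assumes M: "plane_param (proj_pt a) M" and a: "a \<noteq> 0"
    and hom: "homogeneous d f" and v: "v \<noteq> 0" "proj_pt v \<in> Sing (linear_pullback M f)"
  obtains c where "eval (($) (M *v v)) f = 0" "(\<chi> i. eval (($) (M *v v)) (pderiv_mp i f)) = c *s a"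
proof -
  have s: "eval (($) v) (linear_pullback M f) = 0" "\<And>i. eval (($) v) (pderiv_mp i (linear_pullback M f)) = 0"
    using v Sing_iff[OF homogeneous_linear_pullback[OF hom]] by blast+
  have "dir_deriv (linear_pullback M f) v z = 0" for z by (simp add: dir_deriv_def s)
  then have 0: "dot (\<chi> i. eval (($) (M *v v)) (pderiv_mp i f)) (M *v z) = 0" for z
    unfolding dir_deriv_dot[symmetric] by (simp only: dir_deriv_linear_pullback)
  have "dot (\<chi> i. eval (($) (M *v v)) (pderiv_mp i f)) x = 0" if "dot a x = 0" for x
  proof -
    have "x \<in> range ((*v) M)" using M that by (simp add: plane_param_def hyperplane_cone_proj_pt)
    with 0 show ?thesis by blast
  qed
  from dot_eq_zero_multiple[OF a this] obtain c where "(\<chi> i. eval (($) (M *v v)) (pderiv_mp i f)) = c *s a" by blast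
  with s(1) show ?thesis by (intro that[of c]) (simp_all add: eval_linear_pullback)
qed

lemma plane_param_nonzero:
  assumes "plane_param H M" "v \<noteq> 0"
  shows "M *v v \<noteq> 0"
  using assms injD[of "(*v) M" v 0] by (auto simp: plane_param_def)

lemma differential_injective:
  fixes f :: "4 mpoly" and M N :: "complex^3^4"
  assumes d: "d \<ge> 4" and hom: "homogeneous d f"
    and H: "H \<in> proj_space" and M: "plane_param H M"
    and disj: "hyperplane H \<inter> Sing f = {}"
    and nodes: "\<And>p. p \<in> Sing (linear_pullback M f) \<Longrightarrow> is_node (linear_pullback M f) p"
    and nc: "\<not> collinear_pts (Sing (linear_pullback M f))"
    and N: "\<And>y. dir_deriv f (M *v y) (N *v y) = 0"
  shows "N = 0"
proof -
  obtain a where a: "H = proj_pt a" "a \<noteq> 0" using H by (auto simp: proj_space_def)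
  \<comment> \<open>This linear form measures how the plane moves to first order. Once it vanishes,
    \<open>N\<close> only changes the coordinates within the plane.\<close>
  have "(\<chi> j. \<Sum>i\<in>UNIV. a $ i * N $ i $ j) = 0"
  proof (rule noncollinear_functional_zero[OF nc Sing_subset])
    fix v :: "complex^3" assume v: "v \<noteq> 0" "proj_pt v \<in> Sing (linear_pullback M f)"
    obtain c where c: "eval (($) (M *v v)) f = 0" "(\<chi> i. eval (($) (M *v v)) (pderiv_mp i f)) = c *s a"
      using singular_point_pullback[OF M[unfolded a] a(2) hom v] by blast
    have "c \<noteq> 0"
    proof
      assume "c = 0"
      then have "\<forall>i. eval (($) (M *v v)) (pderiv_mp i f) = 0" using c(2) by (simp add: vec_eq_iff)
      with c(1) have "proj_pt (M *v v) \<in> Sing f"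
        using Sing_iff[OF hom plane_param_nonzero[OF M v(1)]] by blast
      moreover have "M *v v \<in> hyperplane_cone H" using M by (auto simp: plane_param_def)
      then have "proj_pt (M *v v) \<in> hyperplane H"
        using plane_param_nonzero[OF M v(1)] by (auto simp: hyperplane_def)
      ultimately show False using disj by blast
    qed
    moreover have "c * dot a (N *v v) = 0"
      using N[of v] by (simp add: dir_deriv_dot c(2) dot_scale_left)
    ultimately show "dot (\<chi> j. \<Sum>i\<in>UNIV. a $ i * N $ i $ j) v = 0" by (simp add: dot_matrix)
  qed
  then have "dot a (N *v x) = 0" for x by (simp add: dot_matrix)
  then have "range ((*v) N) \<subseteq> range ((*v) M)"
    using M by (auto simp: plane_param_def a hyperplane_cone_proj_pt)
  then obtain B where B: "N = M ** B" using matrix_factor by blast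
  have "B = 0"
    by (rule no_linear_syzygy[OF d homogeneous_linear_pullback[OF hom] nodes nc])
       (use N in \<open>simp_all add: dir_deriv_linear_pullback B matrix_vector_mul_assoc\<close>)
  then show ?thesis by (simp add: B matrix_eq matrix_vector_mul_assoc[symmetric])
qed

text \<open>A maximal independent subset of \<open>S\<close> has the same common kernel, and at most
  as many elements as there are coordinates.\<close>

lemma finite_separating_family:
  fixes S :: "(complex^'n::finite) set"
  assumes "\<And>x. (\<And>s. s \<in> S \<Longrightarrow> dot s x = 0) \<Longrightarrow> x = 0"
  shows "\<exists>s :: 'n \<Rightarrow> complex^'n. (\<forall>k. s k \<in> S) \<and> (\<forall>x. (\<forall>k. dot (s k) x = 0) \<longrightarrow> x = 0)"
proof -
  obtain B where B: "B \<subseteq> S" "vec.independent B" "S \<subseteq> vec.span B"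
    using vec.maximal_independent_subset by blast
  have fB: "finite B" using vec.finiteI_independent[OF B(2)] .
  have "card B \<le> CARD('n)" using vec.independent_card_le_dim[OF subset_UNIV B(2)] by (simp add: card_cart_basis)
  have ker: "x = 0" if "\<And>b. b \<in> B \<Longrightarrow> dot b x = 0" for x
  proof (rule assms)
    fix s assume "s \<in> S"
    then have "s \<in> vec.span B" using B by blast
    then show "dot s x = 0"
      by (induction rule: vec.span_induct_alt) (simp_all add: dot_add_left dot_scale_left that)
  qed
  have "B \<noteq> {}"
  proof
    assume "B = {}"
    then have "axis undefined 1 = (0 :: complex^'n)" using ker by blast
    then show False by (simp add: axis_eq_0_iff)
  qed
  then obtain b0 where b0: "b0 \<in> B" by blast
  obtain \<phi> :: "complex^'n \<Rightarrow> 'n" where \<phi>: "inj_on \<phi> B"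
    using card_le_inj[OF fB finite \<open>card B \<le> CARD('n)\<close>] by blast
  \<comment> \<open>The default \<open>b0\<close> fills the indices that no element of
    \<open>B\<close> uses.\<close>
  define s where "s k = (if k \<in> \<phi> ` B then inv_into B \<phi> k else b0)" for k
  have "s k \<in> S" for k using b0 B(1) by (auto simp: s_def inv_into_into)
  moreover have "x = 0" if "\<forall>k. dot (s k) x = 0" for x
  proof (rule ker)
    fix b assume "b \<in> B"
    then have "s (\<phi> b) = b" using \<phi> by (simp add: s_def)
    with that show "dot b x = 0" by metis
  qed
  ultimately show ?thesis by blast
qed

subsection \<open>Generic finiteness on parametrized planes\<close>

lemma has_derivative_vec_lambda:
  fixes f :: "'a::real_normed_vector \<Rightarrow> 'n::finite \<Rightarrow> complex"
  assumes "\<And>k. ((\<lambda>x. f x k) has_derivative (\<lambda>w. f' w k)) (at x)"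
  shows "((\<lambda>x. \<chi> k. f x k) has_derivative (\<lambda>w. \<chi> k. f' w k)) (at x)"
  by (rule iffD2[OF has_derivative_componentwise_within])
     (auto simp: Basis_vec_def inner_axis intro!: has_derivative_inner_left assms)

text \<open>Matrices are flattened to vectors, so that the differential of the sampled section map
  becomes a square matrix.\<close>

definition mat_of :: "complex^('n \<times> 'm) \<Rightarrow> complex^'m^'n" where
  "mat_of N = (\<chi> i j. N $ (i, j))"

lemma dot_mat_of:
  "dot (\<chi> q. a $ fst q * y $ snd q) N = dot a (mat_of N *v y)"
proof -
  have "dot (\<chi> q. a $ fst q * y $ snd q) N = (\<Sum>(i, j)\<in>UNIV \<times> UNIV. a $ i * y $ j * N $ (i, j))"
    by (simp add: dot_def case_prod_unfold)
  also have "\<dots> = (\<Sum>i\<in>UNIV. \<Sum>j\<in>UNIV. a $ i * y $ j * N $ (i, j))"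
    by (rule sum.cartesian_product[symmetric])
  also have "\<dots> = dot a (mat_of N *v y)"
    by (simp add: dot_def mat_of_def matrix_vector_mult_def sum_distrib_left mult_ac)
  finally show ?thesis .
qed

lemma mat_of_linear: "bounded_linear (\<lambda>N :: complex^('n::finite \<times> 'm::finite). mat_of N *v y)"
proof -
  have *: "(\<lambda>N. mat_of N *v y) = (\<lambda>N. \<chi> i. dot (\<chi> q. axis i 1 $ fst q * y $ snd q) N)"
    by (simp add: fun_eq_iff vec_eq_iff dot_mat_of) (simp add: dot_def axis_def if_distrib[of "\<lambda>x. x * _"] cong: if_cong)
  have "((\<lambda>N. \<chi> i. dot (\<chi> q. axis i 1 $ fst q * y $ snd q) N) has_derivative
      (\<lambda>N. \<chi> i. dot (\<chi> q. axis i 1 $ fst q * y $ snd q) N)) (at (0 :: complex^('n::finite \<times> 'm::finite)))"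
    by (intro has_derivative_vec_lambda bounded_linear_imp_has_derivative bounded_linear_dot)
  from has_derivative_bounded_linear[OF this] show ?thesis by (simp only: *)
qed

text \<open>
  Values at sample points replace coefficients as coordinates of a form: they are linear in the
  coefficients, and for \<open>linear_pullback M f\<close> they depend on \<open>M\<close> in an explicit way.
\<close>

definition samples :: "('k \<Rightarrow> complex^'n::finite) \<Rightarrow> 'n mpoly \<Rightarrow> 'k \<Rightarrow> complex" where
  "samples y g k = eval (($) (y k)) g"

text \<open>The evaluations at all points \<open>y\<close> have no common kernel on the tangent
  vectors \<open>N\<close>, so as many points as there are matrix entries suffice. The sampled map
  between spaces of equal dimension then has a ball in its image, and a polynomial that vanishes on
  a ball is zero.\<close>

lemma samples_algebraically_independent:
  fixes f :: "'n::finite mpoly" and M0 :: "complex^'m::finite^'n"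
  assumes inj: "\<And>N :: complex^'m^'n. (\<And>y. dir_deriv f (M0 *v y) (N *v y) = 0) \<Longrightarrow> N = 0"
  obtains y :: "'n \<times> 'm \<Rightarrow> complex^'m" where
    "\<And>c z. polyfun c \<Longrightarrow> c z \<noteq> 0 \<Longrightarrow> \<exists>M :: complex^'m^'n. c (samples y (linear_pullback M f)) \<noteq> 0"
proof -
  define r :: "complex^'m \<Rightarrow> complex^('n \<times> 'm)" where
    "r y = (\<chi> q. (\<chi> i. eval (($) (M0 *v y)) (pderiv_mp i f)) $ fst q * y $ snd q)" for y
  have r: "dot (r y) N = dir_deriv f (M0 *v y) (mat_of N *v y)" for y N
    by (simp only: r_def dot_mat_of dir_deriv_dot)
  have sep: "x = 0" if "\<And>s. s \<in> range r \<Longrightarrow> dot s x = 0" for x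
  proof -
    have "mat_of x = 0" by (rule inj) (use that in \<open>auto simp: r[symmetric]\<close>)
    then show ?thesis by (auto simp: mat_of_def vec_eq_iff)
  qed
  have "\<exists>s :: 'n \<times> 'm \<Rightarrow> complex^('n \<times> 'm). (\<forall>k. s k \<in> range r) \<and> (\<forall>x. (\<forall>k. dot (s k) x = 0) \<longrightarrow> x = 0)"
    by (rule finite_separating_family[OF sep])
  then obtain s :: "'n \<times> 'm \<Rightarrow> complex^('n \<times> 'm)"
    where s: "\<forall>k. s k \<in> range r" "\<forall>x. (\<forall>k. dot (s k) x = 0) \<longrightarrow> x = 0"
    by (elim exE conjE)
  have "\<forall>k. \<exists>y. s k = r y" using s(1) by blast
  then obtain y where y: "\<And>k. s k = r (y k)" by metis
  define A where "A = (\<chi> k. s k)"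
  have A: "(A *v N) $ k = dir_deriv f (M0 *v y k) (mat_of N *v y k)" for N k
    by (simp add: matrix_vector_nth A_def y r)
  have "inj ((*v) A)"
  proof (rule injI)
    fix u v assume "A *v u = A *v v"
    then have "A *v (u - v) = 0" by (simp add: matrix_vector_mult_diff_distrib)
    then have "\<forall>k. dot (s k) (u - v) = 0" unfolding vec_eq_iff by (simp add: matrix_vector_nth A_def)
    then have "u - v = 0" using s(2) by blast
    then show "u = v" by simp
  qed
  then obtain A' where "A' ** A = mat 1" using matrix_left_invertible_injective by blast
  then have A': "A ** A' = mat 1" using matrix_left_right_inverse by blast
  define \<Theta> where "\<Theta> N = (\<chi> k. eval (($) (mat_of N *v y k)) f)" for N
  have der: "(\<Theta> has_derivative (\<lambda>N. \<chi> k. dir_deriv f (mat_of N1 *v y k) (mat_of N *v y k))) (at N1)" for N1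
    unfolding \<Theta>_def[abs_def]
    by (intro has_derivative_vec_lambda has_derivative_compose[OF _ has_derivative_dir_deriv]
        bounded_linear_imp_has_derivative mat_of_linear)
  define N0 :: "complex^('n \<times> 'm)" where "N0 = (\<chi> q. M0 $ fst q $ snd q)"
  have N0: "mat_of N0 = M0" by (simp add: mat_of_def N0_def vec_eq_iff)
  have "(\<lambda>N. \<chi> k. dir_deriv f (mat_of N0 *v y k) (mat_of N *v y k)) = (*v) A"
    by (simp add: fun_eq_iff vec_eq_iff A N0)
  with der[of N0] have der0: "(\<Theta> has_derivative (*v) A) (at N0)" by simp
  have cont: "continuous_on UNIV \<Theta>"
    by (intro continuous_at_imp_continuous_on ballI has_derivative_continuous[OF der])
  \<comment> \<open>The open mapping theorem asks for continuity and for a right inverse of the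
    derivative at the single point \<open>N0\<close>, here \<open>A'\<close>.\<close>
  have "\<Theta> N0 \<in> interior (\<Theta> ` UNIV)"
    by (rule sussmann_open_mapping[OF open_UNIV cont _ der0 matrix_vector_mul_bounded_linear[of A']])
       (auto simp: fun_eq_iff matrix_vector_mul_assoc A')
  then obtain e where e: "e > 0" "ball (\<Theta> N0) e \<subseteq> range \<Theta>" by (auto simp: mem_interior)
  have \<Theta>: "($) (\<Theta> N) = samples y (linear_pullback (mat_of N) f)" for N
    by (simp add: fun_eq_iff \<Theta>_def samples_def eval_linear_pullback)
  have "\<exists>M :: complex^'m^'n. c (samples y (linear_pullback M f)) \<noteq> 0" if c: "polyfun c" "c z \<noteq> 0" for c z
  proof (rule ccontr)
    assume "\<not> ?thesis"
    then have 0: "c (($) (\<Theta> N)) = 0" for N by (simp add: \<Theta>)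
    define w where "w = (\<chi> k. z k - \<Theta> N0 $ k)"
    obtain P where P: "\<And>t. c (\<lambda>k. \<Theta> N0 $ k + t * (z k - \<Theta> N0 $ k)) = poly P t"
      using polyfun_line[OF c(1), of "($) (\<Theta> N0)" "\<lambda>k. z k - \<Theta> N0 $ k"] by blast
    \<comment> \<open>Small real parameters stay in the ball and give infinitely many roots of
      \<open>P\<close>, while the value of \<open>P\<close> at 1 is \<open>c z\<close>.\<close>
    have "poly P (of_real t) = 0" if "t \<in> {0<..<e / (norm w + 1)}" for t
    proof -
      have "t * norm w < e"
      proof -
        have "t * (norm w + 1) < e" using that by (simp add: pos_less_divide_eq add_nonneg_pos)
        then show ?thesis using that by (auto simp: algebra_simps)
      qed
      then have "\<Theta> N0 + t *\<^sub>R w \<in> ball (\<Theta> N0) e" using that by (simp add: dist_norm)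
      with e obtain N where "\<Theta> N0 + t *\<^sub>R w = \<Theta> N" by blast
      then have "($) (\<Theta> N) = (\<lambda>k. \<Theta> N0 $ k + of_real t * (z k - \<Theta> N0 $ k))"
        by (simp add: fun_eq_iff w_def vec_eq_iff scaleR_conv_of_real[where 'a=complex])
      with 0[of N] P[of "of_real t"] show ?thesis by simp
    qed
    then have "of_real ` {0<..<e / (norm w + 1)} \<subseteq> {t. poly P t = 0}" by auto
    moreover have "infinite ((of_real :: real \<Rightarrow> complex) ` {0<..<e / (norm w + 1)})"
      using e(1) by (subst finite_image_iff) (auto simp: inj_on_def add_nonneg_pos)
    ultimately have "P = 0" using poly_roots_finite finite_subset by metis
    then show False using P[of 1] c(2) by simp
  qed
  with that show ?thesis by blast
qed

lemma finite_matrices: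
  assumes "\<And>i j. finite (F i j)"
  shows "finite {M :: complex^'m::finite^'n::finite. \<forall>i j. M $ i $ j \<in> F i j}"
proof (rule finite_subset)
  show "{M :: complex^'m^'n. \<forall>i j. M $ i $ j \<in> F i j} \<subseteq>
     (\<lambda>h. \<chi> i j. h (i, j)) ` (PiE UNIV (\<lambda>(i, j). F i j))"
  proof
    fix M :: "complex^'m^'n" assume M: "M \<in> {M. \<forall>i j. M $ i $ j \<in> F i j}"
    show "M \<in> (\<lambda>h. \<chi> i j. h (i, j)) ` (PiE UNIV (\<lambda>(i, j). F i j))"
      by (rule image_eqI[of _ _ "\<lambda>(i, j). M $ i $ j"]) (use M in \<open>auto simp: vec_eq_iff\<close>)
  qed
  show "finite ((\<lambda>h. \<chi> i j. h (i, j)) ` (PiE UNIV (\<lambda>(i, j). F i j)))"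
    using assms by (intro finite_imageI finite_PiE) auto
qed

text \<open>\<open>C\<close> is phrased in the sample values of an arbitrary form \<open>g\<close>,
  not only of \<open>f \<circ> M\<close>; this turns its nonvanishing into an open condition on all
  curves.\<close>

lemma generic_finiteness:
  fixes f :: "'n::finite mpoly" and M0 :: "complex^'m::finite^'n"
  assumes inj: "\<And>N :: complex^'m^'n. (\<And>y. dir_deriv f (M0 *v y) (N *v y) = 0) \<Longrightarrow> N = 0"
  shows "\<exists>(y :: 'n \<times> 'm \<Rightarrow> complex^'m) C. polyfun C \<and>
    (\<exists>M :: complex^'m^'n. C (samples y (linear_pullback M f)) \<noteq> 0) \<and>
    (\<forall>g. C (samples y g) \<noteq> 0 \<longrightarrow> finite {M :: complex^'m^'n. linear_pullback M f = g})"
proof -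
  obtain y :: "'n \<times> 'm \<Rightarrow> complex^'m" where y:
    "\<And>c z. polyfun c \<Longrightarrow> c z \<noteq> 0 \<Longrightarrow> \<exists>M :: complex^'m^'n. c (samples y (linear_pullback M f)) \<noteq> 0"
    using samples_algebraically_independent[OF inj] by blast
  \<comment> \<open>\<open>T k\<close> is the value of \<open>f\<close> at \<open>M *v y k\<close>
    for a matrix \<open>M\<close> of indeterminates.\<close>
  define T :: "'n \<times> 'm \<Rightarrow> ('n \<times> 'm) mpoly" where
    "T k = subst_mp (\<lambda>i. \<Sum>j\<in>UNIV. Const (y k $ j) * Var (i, j)) f" for k
  have T: "(\<lambda>k. eval x (T k)) = samples y (linear_pullback (\<chi> i j. x (i, j)) f)" for x
  proof
    fix k
    have "($) ((\<chi> i j. x (i, j)) *v y k) = (\<lambda>i. \<Sum>j\<in>UNIV. y k $ j * x (i, j))"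
      by (simp add: fun_eq_iff matrix_vector_mult_def mult.commute)
    then show "eval x (T k) = samples y (linear_pullback (\<chi> i j. x (i, j)) f) k"
      by (simp add: T_def samples_def eval_linear_pullback eval_subst_mp eval_sum eval_mult)
  qed
  have "\<exists>h. (\<exists>k<fst h. snd h k \<noteq> 0) \<and> (\<forall>x. (\<Sum>k<fst h. eval (\<lambda>i. eval x (T i)) (snd h k) * x q ^ k) = 0)" for q
  proof -
    obtain D R where "\<exists>k<D. R k \<noteq> 0" "\<And>x. (\<Sum>k<D. eval (\<lambda>i. eval x (T i)) (R k) * eval x (Var q) ^ k) = 0"
      by (rule algebraic_dependence[where P = "Var q" and T = T]) (assumption | rule that)+
    then show ?thesis by (intro exI[of _ "(D, R)"]) simp
  qed
  then have "\<forall>q. \<exists>h. (\<exists>k<fst h. snd h k \<noteq> 0) \<and> (\<forall>x. (\<Sum>k<fst h. eval (\<lambda>i. eval x (T i)) (snd h k) * x q ^ k) = 0)"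
    by (rule allI)
  from choice[OF this] obtain h where h: "\<forall>q. (\<exists>k<fst (h q). snd (h q) k \<noteq> 0)
      \<and> (\<forall>x. (\<Sum>k<fst (h q). eval (\<lambda>i. eval x (T i)) (snd (h q) k) * x q ^ k) = 0)" by (elim exE)
  define D where "D q = fst (h q)" for q
  define R where "R q = snd (h q)" for q
  have DR: "\<exists>k<D q. R q k \<noteq> 0" "(\<Sum>k<D q. eval (\<lambda>i. eval x (T i)) (R q k) * x q ^ k) = 0" for q x
    using h[rule_format, of q] by (auto simp: D_def R_def)
  \<comment> \<open>Any nonzero coefficient serves: it has to keep the polynomial for the entry
    \<open>q\<close> from being identically zero.\<close>
  then obtain k where k: "\<And>q. k q < D q" "\<And>q. R q (k q) \<noteq> 0"
  proof -
    have "\<forall>q. \<exists>k. k < D q \<and> R q k \<noteq> 0" using DR(1) by blast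
    then have "\<exists>k. \<forall>q. k q < D q \<and> R q (k q) \<noteq> 0" by (rule choice)
    then show ?thesis using that by blast
  qed
  define C where "C z = (\<Prod>q\<in>UNIV. eval z (R q (k q)))" for z
  \<comment> \<open>Algebraic independence of the samples enters here: a nonzero polynomial stays
    nonzero after insertion of the \<open>T\<close>.\<close>
  have nz: "\<exists>x. eval (\<lambda>i. eval x (T i)) (R q (k q)) \<noteq> 0" for q
  proof -
    obtain z where "eval z (R q (k q)) \<noteq> 0" using k(2) mpoly_zeroI by blast
    then obtain M :: "complex^'m^'n" where "eval (samples y (linear_pullback M f)) (R q (k q)) \<noteq> 0"
      using y[OF polyfun_eval] by blast
    moreover have "M = (\<chi> i j. (\<lambda>(i, j). M $ i $ j) (i, j))" by (simp add: vec_eq_iff)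
    ultimately show ?thesis using T[of "\<lambda>(i, j). M $ i $ j"] by metis
  qed
  have "\<exists>x. \<forall>q\<in>UNIV. eval (\<lambda>i. eval x (T i)) (R q (k q)) \<noteq> 0"
  proof (rule polyfun_common_nonzero_set)
    fix q show "polyfun (\<lambda>x. eval (\<lambda>i. eval x (T i)) (R q (k q)))"
      by (rule polyfun_compose[OF polyfun_eval polyfun_eval])
  qed (simp_all add: nz)
  then obtain x where "\<And>q. eval (\<lambda>i. eval x (T i)) (R q (k q)) \<noteq> 0" by blast
  then have "C (samples y (linear_pullback (\<chi> i j. x (i, j)) f)) \<noteq> 0" by (simp add: C_def T)
  moreover have "finite {M :: complex^'m^'n. linear_pullback M f = g}" if C: "C (samples y g) \<noteq> 0" for g
  proof -
    \<comment> \<open>The polynomial depends on \<open>g\<close> alone, and the entry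
      \<open>q\<close> of every matrix in the fibre is a root.\<close>
    define p where "p q = (\<Sum>k<D q. Polynomial.monom (eval (samples y g) (R q k)) k)" for q
    have "p q \<noteq> 0" for q
    proof
      assume "p q = 0"
      then have "0 = Polynomial.coeff (p q) (k q)" by simp
      also have "\<dots> = eval (samples y g) (R q (k q))"
        using k(1)[of q] by (simp add: p_def coeff_sum)
      finally show False using C by (cases q) (auto simp: C_def)
    qed
    then have fin: "finite {t. poly (p q) t = 0}" for q using poly_roots_finite by blast
    have "poly (p (i, j)) (M $ i $ j) = 0" if M: "linear_pullback M f = g" for M :: "complex^'m^'n" and i j
    proof -
      have "M = (\<chi> i j. (\<lambda>(i, j). M $ i $ j) (i, j))" by (simp add: vec_eq_iff)
      then have "(\<lambda>k. eval (\<lambda>(i, j). M $ i $ j) (T k)) = samples y g"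
        using T[of "\<lambda>(i, j). M $ i $ j"] M by metis
      then show ?thesis using DR(2)[where q = "(i, j)" and x = "\<lambda>(i, j). M $ i $ j"]
        by (simp add: p_def poly_sum poly_monom)
    qed
    then have "{M :: complex^'m^'n. linear_pullback M f = g} \<subseteq> {M. \<forall>i j. M $ i $ j \<in> {t. poly (p (i, j)) t = 0}}"
      by auto
    then show ?thesis using finite_subset finite_matrices[of "\<lambda>i j. {t. poly (p (i, j)) t = 0}"] fin by blast
  qed
  moreover have "polyfun C" unfolding C_def[abs_def] by auto
  ultimately show ?thesis by blast
qed

subsection \<open>Normal vectors and smooth sections\<close>

lemma polyfun_minus: "polyfun p \<Longrightarrow> polyfun q \<Longrightarrow> polyfun (\<lambda>x. p x - q x)"
  unfolding polyfun_def by (metis eval_minus)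

text \<open>
  \<open>skip i\<close> enumerates the indices other than \<open>i\<close>, and the signed maximal minors of a matrix with
  independent columns are the coefficients of the hyperplane that the columns span.
\<close>

definition skip :: "4 \<Rightarrow> 3 \<Rightarrow> 4" where
  "skip i c = (if i = 1 then vector [2, 3, 4] else if i = 2 then vector [1, 3, 4]
     else if i = 3 then vector [1, 2, 4] else vector [1, 2, 3] :: 4^3) $ c"

definition submat :: "4 \<Rightarrow> complex^3^4 \<Rightarrow> complex^3^3" where
  "submat i M = (\<chi> c. M $ skip i c)"

definition normal_vector :: "complex^3^4 \<Rightarrow> complex^4" where
  "normal_vector M = (\<chi> i. (if i = 1 \<or> i = 3 then 1 else -1) * det (submat i M))"

lemma skip_cases: "r = i \<or> (\<exists>c. r = skip i c)"
proof -
  have "\<forall>i r. r = i \<or> (\<exists>c. r = skip i c)"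
    by (simp add: forall_4 skip_def) (metis vector_3)
  then show ?thesis by blast
qed

lemma submat_mult: "(submat i M *v y) $ c = (M *v y) $ skip i c"
  by (simp add: matrix_vector_nth submat_def)

text \<open>For a unit vector \<open>y\<close> this is the Laplace expansion of a determinant with a
  repeated column.\<close>

lemma dot_normal_vector: "dot (normal_vector M) (M *v y) = 0"
  by (simp add: dot_def sum_4 normal_vector_def det_3 submat_def skip_def matrix_vector_mult_def sum_3 algebra_simps)

lemma normal_vector_scale: "normal_vector (M ** mat s) = s ^ 3 *s normal_vector M"
proof -
  have "(M ** mat s) $ i $ j = s * M $ i $ j" for i j
    by (simp add: matrix_matrix_mult_def mat_def if_distrib[of "\<lambda>x. _ * x"] mult.commute cong: if_cong)
  then show ?thesis
    by (simp add: vec_eq_iff normal_vector_def det_3 submat_def power3_eq_cube algebra_simps)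
qed

lemma submat_injective:
  assumes "det (submat i M) \<noteq> 0" "submat i M *v y = 0"
  shows "y = 0"
  using assms by (metis invertible_det_nz matrix_left_invertible_ker invertible_left_inverse)

text \<open>On the plane a coordinate \<open>i\<close> with \<open>a $ i\<close> nonzero is
  determined by the others, so the columns of \<open>M\<close> stay independent after removal of row
  \<open>i\<close>.\<close>

lemma normal_vector_nonzero:
  assumes "plane_param (proj_pt a) M" "a \<noteq> 0"
  shows "normal_vector M \<noteq> 0"
proof -
  obtain i where i: "a $ i \<noteq> 0" using assms(2) by (auto simp: vec_eq_iff)
  have "y = 0" if y: "submat i M *v y = 0" for y
  proof -
    have 0: "(M *v y) $ r = 0" if "r \<noteq> i" for r
      using skip_cases[of r i] that y submat_mult[of i M y] by (metis zero_index)
    have "dot a (M *v y) = 0" using assms(1) by (auto simp: plane_param_def hyperplane_cone_proj_pt)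
    moreover have "dot a (M *v y) = a $ i * (M *v y) $ i"
      unfolding dot_def by (subst sum.remove[of _ i]) (auto simp: 0)
    ultimately have "(M *v y) $ i = 0" using i by simp
    with 0 have "M *v y = 0" by (metis vec_eq_iff zero_index)
    then show ?thesis using plane_param_nonzero[OF assms(1)] by blast
  qed
  then have "det (submat i M) \<noteq> 0"
    by (metis invertible_det_nz matrix_left_invertible_ker invertible_left_inverse)
  then have "normal_vector M $ i \<noteq> 0" by (simp add: normal_vector_def)
  then show ?thesis by auto
qed

text \<open>A nonzero minor solves three of the four coordinate equations; the fourth follows
  because \<open>M *v y\<close> and \<open>x\<close> satisfy the same equation of the plane.\<close>

lemma plane_param_normal_vector:
  assumes "normal_vector M \<noteq> 0"
  shows "plane_param (proj_pt (normal_vector M)) M"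
proof -
  obtain i where i: "normal_vector M $ i \<noteq> 0" using assms by (auto simp: vec_eq_iff)
  then have det: "det (submat i M) \<noteq> 0" by (auto simp: normal_vector_def)
  show ?thesis unfolding plane_param_def hyperplane_cone_proj_pt
  proof
    show "inj ((*v) M)"
    proof (rule injI)
      fix y z assume "M *v y = M *v z"
      then have "M *v (y - z) = 0" by (simp add: matrix_vector_mult_diff_distrib)
      then have "submat i M *v (y - z) = 0" by (simp add: vec_eq_iff submat_mult)
      from submat_injective[OF det this] show "y = z" by simp
    qed
    show "range ((*v) M) = {x. dot (normal_vector M) x = 0}"
    proof safe
      fix y show "dot (normal_vector M) (M *v y) = 0" by (rule dot_normal_vector)
    next
      fix x assume x: "dot (normal_vector M) x = 0"
      obtain B where "submat i M ** B = mat 1" using det invertible_det_nz invertible_right_inverse by blast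
      then have B: "submat i M *v (B *v (\<chi> c. x $ skip i c)) = (\<chi> c. x $ skip i c)"
        by (simp add: matrix_vector_mul_assoc)
      define y where "y = B *v (\<chi> c. x $ skip i c)"
      have "(M *v y) $ skip i c = x $ skip i c" for c
        using arg_cong[OF B, of "\<lambda>z. z $ c"] by (simp add: submat_mult y_def)
      then have 0: "(M *v y - x) $ r = 0" if "r \<noteq> i" for r
        using skip_cases[of r i] that by auto
      have "dot (normal_vector M) (M *v y - x) = 0" by (simp add: dot_diff_right dot_normal_vector x)
      moreover have "dot (normal_vector M) (M *v y - x) = normal_vector M $ i * (M *v y - x) $ i"
        unfolding dot_def by (subst sum.remove[of _ i]) (use 0 in auto)
      ultimately have "(M *v y - x) $ i = 0" using i by simp
      with 0 have "M *v y - x = 0" by (metis vec_eq_iff zero_index)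
      then show "x \<in> range ((*v) M)" by (metis rangeI right_minus_eq)
    qed
  qed
qed

text \<open>A parametrization of the plane with equation \<open>b\<close> has a nonzero multiple of
  \<open>b\<close> as its normal vector. Minors are cubic in the entries, so a cube root corrects
  the factor.\<close>

lemma normal_vector_surj:
  assumes "b \<noteq> 0"
  shows "\<exists>M. normal_vector M = b"
proof -
  have "proj_pt b \<in> proj_space" using assms by (auto simp: proj_space_def)
  then obtain M where M: "plane_param (proj_pt b) M" using plane_param_exists by blast
  have "dot (normal_vector M) x = 0" if "dot b x = 0" for x
  proof -
    have "x \<in> range ((*v) M)" using M that by (simp add: plane_param_def hyperplane_cone_proj_pt)
    then show ?thesis using dot_normal_vector by blast
  qed
  from dot_eq_zero_multiple[OF assms this] obtain \<mu> where \<mu>: "normal_vector M = \<mu> *s b" by blast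
  have "\<mu> \<noteq> 0" using normal_vector_nonzero[OF M assms] \<mu> by auto
  obtain s where s: "1 / \<mu> = s ^ 3" using exists_complex_root[of 3 "1 / \<mu>"] by auto
  have "normal_vector (M ** mat s) = b" using \<open>\<mu> \<noteq> 0\<close> by (simp add: normal_vector_scale \<mu> s[symmetric])
  then show ?thesis ..
qed

lemma polyfun_normal_vector: "polyfun (\<lambda>x. normal_vector (\<chi> i j. x (i, j)) $ i)"
  unfolding normal_vector_def det_3 submat_def vec_lambda_beta
  by (intro polyfun_mult polyfun_add polyfun_minus polyfun_const polyfun_var)

text \<open>
  The lowest coefficient of an algebraic relation between \<open>f\<close> and its partial derivatives, ordered
  by powers of \<open>f\<close>, vanishes on the gradients along \<open>f = 0\<close>.
\<close>

lemma dual_hypersurface: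
  fixes f :: "'v::finite mpoly"
  assumes "f \<noteq> 0"
  obtains P :: "'v mpoly" where "P \<noteq> 0"
    "\<And>x. eval x f = 0 \<Longrightarrow> eval (\<lambda>i. eval x (pderiv_mp i f)) P = 0"
proof -
  let ?T = "\<lambda>i. pderiv_mp i f"
  obtain D R where DR: "\<exists>k<D. R k \<noteq> 0" "\<And>x. (\<Sum>k<D. eval (\<lambda>i. eval x (?T i)) (R k) * eval x f ^ k) = 0"
    by (rule algebraic_dependence[where P = f and T = ?T]) (assumption | rule that)+
  define k where "k = (LEAST k. k < D \<and> R k \<noteq> 0)"
  have k: "k < D" "R k \<noteq> 0" using LeastI_ex[of "\<lambda>k. k < D \<and> R k \<noteq> 0"] DR(1) by (auto simp: k_def)
  have least: "R j = 0" if "j < k" for j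
    using not_less_Least[of j "\<lambda>k. k < D \<and> R k \<noteq> 0"] that k(1) by (auto simp: k_def)
  define S where "S x = (\<Sum>j\<in>{k..<D}. eval (\<lambda>i. eval x (?T i)) (R j) * eval x f ^ (j - k))" for x
  have fS: "eval x f ^ k * S x = 0" for x
  proof -
    have "(\<Sum>j<D. eval (\<lambda>i. eval x (?T i)) (R j) * eval x f ^ j)
        = (\<Sum>j\<in>{k..<D}. eval (\<lambda>i. eval x (?T i)) (R j) * eval x f ^ j)"
      by (rule sum.mono_neutral_right) (auto simp: least not_le)
    also have "\<dots> = eval x f ^ k * S x"
      by (auto simp: S_def sum_distrib_left power_add[symmetric] mult_ac intro!: sum.cong)
    finally show ?thesis using DR(2)[of x] by simp
  qed
  have "polyfun S" unfolding S_def[abs_def]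
    by (intro polyfun_sum polyfun_mult polyfun_power polyfun_eval polyfun_compose[OF polyfun_eval])
  obtain x0 where x0: "eval x0 f \<noteq> 0" using mpoly_zeroI assms by blast
  \<comment> \<open>By \<open>fS\<close> the function \<open>S\<close> can be nonzero only where
    \<open>f\<close> vanishes, but two nonzero polynomials are nonzero at a common point.\<close>
  have S0: "S x = 0" for x
  proof (rule ccontr)
    assume "S x \<noteq> 0"
    from polyfun_common_nonzero[where p = "\<lambda>x. eval x f" and q = S, OF polyfun_eval \<open>polyfun S\<close> x0 this]
    obtain z where "eval z f \<noteq> 0" "S z \<noteq> 0" by blast
    with fS[of z] show False by simp
  qed
  show ?thesis
  proof (rule that[OF k(2)])
    fix x assume x: "eval x f = 0"
    have "S x = (\<Sum>j\<in>{k..<D}. if j = k then eval (\<lambda>i. eval x (?T i)) (R k) else 0)"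
      unfolding S_def by (rule sum.cong) (auto simp: x)
    also have "\<dots> = eval (\<lambda>i. eval x (?T i)) (R k)" using k(1) by simp
    finally show "eval (\<lambda>i. eval x (?T i)) (R k) = 0" using S0 by simp
  qed
qed

text \<open>A singular point of the section off the singular points of the surface is a point of
  tangency, with gradient \<open>c a\<close>. Rescaling it by some \<open>s\<close> with
  \<open>s ^ (d - 1) = 1 / c\<close> makes the gradient equal to \<open>a\<close>, so that
  \<open>P\<close>, which need not be homogeneous, would vanish at \<open>a\<close>.\<close>

lemma smooth_section:
  fixes f :: "4 mpoly"
  assumes d: "d \<ge> 2" and hom: "homogeneous d f"
    and P: "\<And>x. eval x f = 0 \<Longrightarrow> eval (\<lambda>i. eval x (pderiv_mp i f)) P = 0"
    and a: "a \<noteq> 0" "eval (($) a) P \<noteq> 0"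
    and sing: "\<And>v. v \<noteq> 0 \<Longrightarrow> proj_pt v \<in> Sing f \<Longrightarrow> dot a v \<noteq> 0"
    and M: "plane_param (proj_pt a) M"
  shows "smooth_form d (linear_pullback M f)"
proof -
  have "p \<notin> Sing (linear_pullback M f)" for p
  proof
    assume p: "p \<in> Sing (linear_pullback M f)"
    then obtain v where v: "v \<noteq> 0" "p = proj_pt v" by (auto simp: Sing_def)
    obtain c where c: "eval (($) (M *v v)) f = 0" "(\<chi> i. eval (($) (M *v v)) (pderiv_mp i f)) = c *s a"
      using singular_point_pullback[OF M a(1) hom v(1) p[unfolded v(2)]] by blast
    have grad: "eval (($) (M *v v)) (pderiv_mp i f) = c * a $ i" for i
      using arg_cong[OF c(2), of "\<lambda>x. x $ i"] by simp
    show False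
    proof (cases "c = 0")
      case True
      then have "proj_pt (M *v v) \<in> Sing f"
        using Sing_iff[OF hom plane_param_nonzero[OF M v(1)]] c(1) grad by simp
      moreover have "dot a (M *v v) = 0" using M by (auto simp: plane_param_def hyperplane_cone_proj_pt)
      ultimately show False using sing plane_param_nonzero[OF M v(1)] by blast
    next
      case False
      obtain s where s: "1 / c = s ^ (d - 1)" using exists_complex_root[of "d - 1" "1 / c"] d by auto
      have "eval (($) (s *s (M *v v))) f = 0" by (simp add: eval_scale_vec[OF hom] c(1))
      from P[OF this] have "eval (\<lambda>i. eval (($) (s *s (M *v v))) (pderiv_mp i f)) P = 0" .
      moreover have "eval (($) (s *s (M *v v))) (pderiv_mp i f) = a $ i" for i
      proof -
        have "s ^ (d - 1) * c = 1" using False by (simp only: s[symmetric]) simp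
        then show ?thesis
          by (simp only: eval_scale_vec[OF homogeneous_pderiv[OF hom]] grad mult.assoc[symmetric] mult_1)
      qed
      ultimately show False using a(2) by simp
    qed
  qed
  then have S: "Sing (linear_pullback M f) = {}" by blast
  moreover have "linear_pullback M f \<noteq> 0"
  proof
    assume 0: "linear_pullback M f = 0"
    have "(axis 1 1 :: complex^3) \<noteq> 0" by (simp add: axis_eq_0_iff)
    from Sing_iff[OF homogeneous_linear_pullback[OF hom] this, of M]
    have "proj_pt (axis 1 1) \<in> Sing (linear_pullback M f)"
      unfolding 0 by (simp add: pderiv_mp_def)
    with S show False by blast
  qed
  ultimately show ?thesis by (simp add: smooth_form_def homogeneous_linear_pullback[OF hom])
qed

subsection \<open>Generic planes and the moduli space\<close>

text \<open>The range of summation depends only on \<open>m\<close>; hence the coefficients of a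
  product are polynomial in parameters whenever those of the factors are.\<close>

lemma lookup_mult_pairs:
  fixes f g :: "'v::finite mpoly"
  shows "finite {(a, b). a + b = m} \<and>
    Poly_Mapping.lookup (f * g) m = (\<Sum>(a, b)\<in>{(a, b). a + b = m}. Poly_Mapping.lookup f a * Poly_Mapping.lookup g b)"
proof
  let ?S = "{(a, b). a + b = m}"
  let ?s = "\<lambda>f m. Poly_Mapping.single m (Poly_Mapping.lookup f m)"
  let ?K = "Poly_Mapping.keys f \<times> Poly_Mapping.keys g"
  have "Poly_Mapping.lookup a i \<le> mdeg (a + b)" "Poly_Mapping.lookup b i \<le> mdeg (a + b)" for a b :: "'v monom" and i
    using lookup_le_mdeg[of "a + b" i] by (simp_all add: lookup_add)
  then have "?S \<subseteq> monom_box (Suc (mdeg m)) \<times> monom_box (Suc (mdeg m))"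
    by (auto simp: monom_box_def less_Suc_eq_le)
  then show fin: "finite ?S" using monom_box_card by (meson finite_SigmaI finite_subset)
  have "f * g = (\<Sum>a\<in>Poly_Mapping.keys f. ?s f a) * (\<Sum>b\<in>Poly_Mapping.keys g. ?s g b)"
    by (simp add: sum_singles)
  also have "\<dots> = (\<Sum>(a, b)\<in>?K. ?s f a * ?s g b)"
    by (simp add: sum_product sum.cartesian_product)
  finally have "Poly_Mapping.lookup (f * g) m
      = (\<Sum>(a, b)\<in>?K. Poly_Mapping.lookup f a * Poly_Mapping.lookup g b when a + b = m)"
    by (simp add: lookup_sum mult_single lookup_single case_prod_unfold)
  also have "\<dots> = (\<Sum>(a, b)\<in>?K \<inter> ?S. Poly_Mapping.lookup f a * Poly_Mapping.lookup g b)"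
    by (rule sum.mono_neutral_cong_right) (auto simp: when_def split: if_splits)
  also have "\<dots> = (\<Sum>(a, b)\<in>?S. Poly_Mapping.lookup f a * Poly_Mapping.lookup g b)"
    by (rule sum.mono_neutral_left) (use fin in \<open>auto simp: in_keys_iff\<close>)
  finally show "Poly_Mapping.lookup (f * g) m = (\<Sum>(a, b)\<in>?S. Poly_Mapping.lookup f a * Poly_Mapping.lookup g b)" .
qed

definition coeffs_polyfun :: "(('i \<Rightarrow> complex) \<Rightarrow> 'v::finite mpoly) \<Rightarrow> bool" where
  "coeffs_polyfun \<Phi> \<longleftrightarrow> (\<forall>m. polyfun (\<lambda>x. Poly_Mapping.lookup (\<Phi> x) m))"

lemma coeffs_polyfun_const: "coeffs_polyfun (\<lambda>x. g)"
  by (simp add: coeffs_polyfun_def)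

lemma coeffs_polyfun_sum:
  "(\<And>i. i \<in> S \<Longrightarrow> coeffs_polyfun (\<Phi> i)) \<Longrightarrow> coeffs_polyfun (\<lambda>x. \<Sum>i\<in>S. \<Phi> i x)"
  unfolding coeffs_polyfun_def lookup_sum by (auto intro: polyfun_sum)

lemma coeffs_polyfun_mult:
  assumes "coeffs_polyfun \<Phi>" "coeffs_polyfun \<Psi>"
  shows "coeffs_polyfun (\<lambda>x. \<Phi> x * \<Psi> x)"
  unfolding coeffs_polyfun_def lookup_mult_pairs[THEN conjunct2] case_prod_unfold
  using assms by (intro allI polyfun_sum polyfun_mult) (auto simp: coeffs_polyfun_def)

lemma coeffs_polyfun_power: "coeffs_polyfun \<Phi> \<Longrightarrow> coeffs_polyfun (\<lambda>x. \<Phi> x ^ k)"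
  by (induction k) (simp_all add: coeffs_polyfun_const coeffs_polyfun_mult)

lemma coeffs_polyfun_prod:
  "(\<And>i. i \<in> S \<Longrightarrow> coeffs_polyfun (\<Phi> i)) \<Longrightarrow> coeffs_polyfun (\<lambda>x. \<Prod>i\<in>S. \<Phi> i x)"
  by (induction S rule: infinite_finite_induct) (simp_all add: coeffs_polyfun_const coeffs_polyfun_mult)

lemma coeffs_polyfun_Const: "polyfun p \<Longrightarrow> coeffs_polyfun (\<lambda>x. Const (p x))"
  unfolding coeffs_polyfun_def Const_def lookup_single
proof
  fix m assume "polyfun p"
  then show "polyfun (\<lambda>x. p x when 0 = m)" by (cases "m = 0") (auto simp: when_def)
qed

lemma coeffs_polyfun_linear_pullback:
  fixes f :: "'n::finite mpoly"
  shows "coeffs_polyfun (\<lambda>x. linear_pullback (\<chi> i j. x (i, j) :: complex^'m::finite^'n) f)"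
proof -
  have *: "linear_pullback M f = (\<Sum>m\<in>Poly_Mapping.keys f. Const (Poly_Mapping.lookup f m) *
      (\<Prod>i\<in>Poly_Mapping.keys m. (\<Sum>j\<in>UNIV. Const (M $ i $ j) * Var j) ^ Poly_Mapping.lookup m i))" for M :: "complex^'m^'n"
    by (simp add: affine_pullback_def mp_eval_def linear_form_def Const_def[of 0])
  show ?thesis
    unfolding * vec_lambda_beta
    by (intro coeffs_polyfun_sum coeffs_polyfun_mult coeffs_polyfun_prod coeffs_polyfun_power
          coeffs_polyfun_Const coeffs_polyfun_const polyfun_var)
qed

text \<open>Each condition is the nonvanishing of a polynomial in the twelve entries of
  \<open>M\<close>, so they can be met one at a time: those on \<open>C\<close> and \<open>p\<close>
  at the given matrices, those for smoothness at suitable normal vectors, which occur by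
  \<open>normal_vector_surj\<close>.\<close>

lemma generic_plane:
  fixes f :: "4 mpoly" and y :: "'k \<Rightarrow> complex^3"
  assumes d: "d \<ge> 2" and f: "f \<noteq> 0" "homogeneous d f" and fin: "finite (Sing f)"
    and C: "polyfun C" "C (samples y (linear_pullback M0 f)) \<noteq> 0"
    and p: "polyfun p" "p (Poly_Mapping.lookup (linear_pullback M1 f)) \<noteq> 0"
  obtains H M where "H \<in> section_domain d f" "plane_param H M"
    "C (samples y (linear_pullback M f)) \<noteq> 0" "p (Poly_Mapping.lookup (linear_pullback M f)) \<noteq> 0"
proof -
  define mx where "mx x = (\<chi> i j. x (i, j))" for x :: "4 \<times> 3 \<Rightarrow> complex"
  have mx: "\<exists>x. mx x = M" for M
    by (rule exI[of _ "\<lambda>(i, j). M $ i $ j"]) (simp add: mx_def vec_eq_iff)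
  have nv: "polyfun (\<lambda>x. normal_vector (mx x) $ i)" for i
    unfolding mx_def by (rule polyfun_normal_vector)
  have mxnv: "\<exists>x. normal_vector (mx x) = b" if "b \<noteq> 0" for b
    using normal_vector_surj[OF that] mx by metis
  obtain P where P: "P \<noteq> 0" "\<And>x. eval x f = 0 \<Longrightarrow> eval (\<lambda>i. eval x (pderiv_mp i f)) P = 0"
    using dual_hypersurface[OF f(1)] by metis
  define q1 where "q1 x = p (Poly_Mapping.lookup (linear_pullback (mx x) f))" for x
  define q2 where "q2 x = C (samples y (linear_pullback (mx x) f))" for x
  \<comment> \<open>\<open>P\<close> may be nonzero at the origin; the extra factor keeps the normal
    vector from being zero.\<close>
  define q3 where "q3 x = eval (\<lambda>i. normal_vector (mx x) $ i) P * normal_vector (mx x) $ 1" for x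
  define q4 where "q4 v x = dot (normal_vector (mx x)) v" for v x
  \<comment> \<open>One representative vector for each singular point; as there are finitely many,
    the plane can avoid all of them by one product.\<close>
  define V where "V = (\<lambda>p. SOME v. v \<noteq> 0 \<and> proj_pt v = p) ` Sing f"
  have V: "(SOME v. v \<noteq> 0 \<and> proj_pt v = p) \<noteq> 0 \<and> proj_pt (SOME v. v \<noteq> 0 \<and> proj_pt v = p) = p" if "p \<in> Sing f" for p
    by (rule someI_ex) (use that in \<open>auto simp: Sing_def\<close>)
  have "coeffs_polyfun (\<lambda>x. linear_pullback (mx x) f)"
    unfolding mx_def by (rule coeffs_polyfun_linear_pullback)
  then have "polyfun q1" unfolding q1_def coeffs_polyfun_def
    by (intro polyfun_compose[OF p(1)]) blast
  moreover have "\<exists>x. q1 x \<noteq> 0" using mx[of M1] p(2) by (auto simp: q1_def)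
  moreover have "polyfun q2"
  proof -
    have "polyfun (\<lambda>x. samples y (linear_pullback (mx x) f) k)" for k
    proof -
      have "samples y (linear_pullback (mx x) f) k = eval (\<lambda>i. \<Sum>j\<in>UNIV. x (i, j) * y k $ j) f" for x
        by (simp add: samples_def eval_linear_pullback matrix_vector_mult_def mx_def vec_lambda_inverse)
      then show ?thesis
        by (simp only:) (intro polyfun_compose[OF polyfun_eval] polyfun_sum polyfun_mult polyfun_const polyfun_var)
    qed
    then show ?thesis unfolding q2_def by (rule polyfun_compose[OF C(1)])
  qed
  moreover have "\<exists>x. q2 x \<noteq> 0" using mx[of M0] C(2) by (auto simp: q2_def)
  moreover have "polyfun q3" unfolding q3_def
    by (intro polyfun_mult polyfun_compose[OF polyfun_eval] nv)
  moreover have "\<exists>x. q3 x \<noteq> 0"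
  proof -
    obtain z where "eval z P \<noteq> 0" using mpoly_zeroI P(1) by blast
    then obtain b where b: "eval b P \<noteq> 0" "b 1 \<noteq> 0"
      using polyfun_common_nonzero[where p = "\<lambda>x. eval x P" and q = "\<lambda>x. x 1" and a = z and b = "\<lambda>_. 1"] by auto
    have v: "($) (\<chi> i. b i) = b" by (simp add: fun_eq_iff)
    have "(\<chi> i. b i) \<noteq> 0" using b(2) by (auto simp: vec_eq_iff)
    from mxnv[OF this] obtain x where "normal_vector (mx x) = (\<chi> i. b i)" by blast
    then have "q3 x \<noteq> 0" using b by (simp add: q3_def v)
    then show ?thesis by blast
  qed
  moreover have "polyfun (\<lambda>x. \<Prod>v\<in>V. q4 v x)" unfolding q4_def dot_def
    by (intro polyfun_prod polyfun_sum polyfun_mult nv polyfun_const)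
  moreover have "\<exists>x. (\<Prod>v\<in>V. q4 v x) \<noteq> 0"
  proof -
    have "\<exists>x. \<forall>v\<in>V. q4 v x \<noteq> 0"
    proof (rule polyfun_common_nonzero_set)
      show "finite V" using fin by (simp add: V_def)
      fix v assume "v \<in> V"
      show "polyfun (q4 v)" unfolding q4_def dot_def
        by (intro polyfun_sum polyfun_mult nv polyfun_const)
      have "v \<noteq> 0" using \<open>v \<in> V\<close> V by (auto simp: V_def)
      then obtain i where i: "v $ i \<noteq> 0" by (auto simp: vec_eq_iff)
      have "(axis i 1 :: complex^4) \<noteq> 0" by (simp add: axis_eq_0_iff)
      from mxnv[OF this] obtain x where "normal_vector (mx x) = axis i 1" by blast
      then have "q4 v x \<noteq> 0"
        using i by (simp add: q4_def dot_def axis_def if_distrib[of "\<lambda>x. x * _"] cong: if_cong)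
      then show "\<exists>x. q4 v x \<noteq> 0" by blast
    qed
    then show ?thesis using fin by (simp add: V_def)
  qed
  ultimately have "\<exists>x. \<forall>q\<in>{q1, q2, q3, \<lambda>x. \<Prod>v\<in>V. q4 v x}. q x \<noteq> 0"
    by (intro polyfun_common_nonzero_set) auto
  then obtain x where x: "q1 x \<noteq> 0" "q2 x \<noteq> 0" "q3 x \<noteq> 0" "(\<Prod>v\<in>V. q4 v x) \<noteq> 0" by auto
  define M where "M = mx x"
  define a where "a = normal_vector M"
  have a0: "a \<noteq> 0" and aP: "eval (($) a) P \<noteq> 0" using x(3) by (auto simp: q3_def a_def M_def)
  have "finite V" using fin by (simp add: V_def)
  with x(4) have aV: "dot a v \<noteq> 0" if "v \<in> V" for v using that by (auto simp: q4_def a_def M_def)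
  have sing: "dot a v \<noteq> 0" if v: "v \<noteq> 0" "proj_pt v \<in> Sing f" for v
  proof -
    obtain w where w: "w \<in> V" "proj_pt w = proj_pt v" using V[OF v(2)] v(2) unfolding V_def by blast
    obtain c where "c \<noteq> 0" "v = c *s w" using proj_pt_eqD[OF w(2)[symmetric] v(1)] by blast
    with aV[OF w(1)] show ?thesis by (simp add: dot_scale_right)
  qed
  have param: "plane_param (proj_pt a) M" using plane_param_normal_vector a0 by (simp add: a_def)
  have aH: "proj_pt a \<in> proj_space" using a0 by (auto simp: proj_space_def)
  obtain M' where M': "plane_param (proj_pt a) M'" "plane_section f (proj_pt a) = linear_pullback M' f"
    using plane_section_param[OF aH] by metis
  have "smooth_form d (plane_section f (proj_pt a))"
    unfolding M'(2) by (rule smooth_section[OF d f(2) P(2) a0 aP sing M'(1)])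
  then have "proj_pt a \<in> section_domain d f" using aH by (simp add: section_domain_def)
  from that[OF this param] x(1,2) show ?thesis by (simp add: q1_def q2_def M_def)
qed

section \<open>Linear equivalence of forms and orbits of plane curves\<close>

definition lin_equiv :: "'n::finite mpoly \<Rightarrow> 'n mpoly \<Rightarrow> bool" where
  "lin_equiv h g \<longleftrightarrow> (\<exists>A :: complex^'n^'n. invertible A \<and> h = linear_pullback A g)"

lemma lin_equiv_refl: "lin_equiv g g"
  unfolding lin_equiv_def by (rule exI[of _ "mat 1"]) (simp add: invertible_mat)

lemma lin_equiv_sym:
  assumes "lin_equiv h g"
  shows "lin_equiv g h"
proof -
  obtain A where A: "invertible A" "h = linear_pullback A g" using assms by (auto simp: lin_equiv_def)
  then obtain B where B: "A ** B = mat 1" "B ** A = mat 1" by (auto simp: invertible_def)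
  have "g = linear_pullback B h" by (simp add: A linear_pullback_compose B)
  moreover have "invertible B" using B by (auto simp: invertible_def)
  ultimately show ?thesis by (auto simp: lin_equiv_def)
qed

lemma lin_equiv_trans: "lin_equiv h g \<Longrightarrow> lin_equiv g k \<Longrightarrow> lin_equiv h k"
  unfolding lin_equiv_def using linear_pullback_compose invertible_mult by metis

text \<open>A scalar matrix \<open>s\<close> multiplies forms of degree \<open>d\<close> by
  \<open>s ^ d\<close>, and every complex number is a \<open>d\<close>-th power. So equivalence of
  forms also describes orbits of curves, where forms count up to scalars.\<close>

lemma lin_equiv_scale:
  assumes "homogeneous d g" "d \<noteq> 0" "c \<noteq> 0"
  shows "lin_equiv (Const c * g) g"
proof -
  obtain s where s: "c = s ^ d" using exists_complex_root[OF assms(2)] by metis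
  with assms have "s \<noteq> 0" by (auto simp: power_0_left)
  then show ?thesis unfolding lin_equiv_def s
    using linear_pullback_mat[OF assms(1), of s] invertible_mat[of s] by metis
qed

lemma lin_equiv_smooth:
  assumes "lin_equiv h g" "smooth_form d g"
  shows "smooth_form d h"
proof -
  obtain A where A: "invertible A" "h = linear_pullback A g" using assms by (auto simp: lin_equiv_def)
  obtain B where B: "A ** B = mat 1" "B ** A = mat 1" using A by (auto simp: invertible_def)
  have hom: "homogeneous d g" and g: "g \<noteq> 0" "Sing g = {}" using assms(2) by (auto simp: smooth_form_def)
  have "p \<notin> Sing h" for p
  proof
    assume p: "p \<in> Sing h"
    then obtain v where v: "v \<noteq> 0" "p = proj_pt v" by (auto simp: Sing_def)
    have s: "eval (($) v) h = 0" "\<And>i. eval (($) v) (pderiv_mp i h) = 0"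
      using p v Sing_iff[OF homogeneous_linear_pullback[OF hom] v(1), of A] by (auto simp: A)
    have "A *v v \<noteq> 0"
      using v(1) B(2) by (metis matrix_vector_mul_assoc matrix_vector_mul_lid matrix_vector_mult_0_right)
    moreover have "eval (($) (A *v v)) g = 0" using s(1) by (simp add: A eval_linear_pullback)
    moreover have "eval (($) (A *v v)) (pderiv_mp i g) = 0" for i
    proof -
      have "dir_deriv h v (B *v axis i 1) = 0" by (simp add: dir_deriv_def s)
      then show ?thesis by (simp add: A dir_deriv_linear_pullback matrix_vector_mul_assoc B)
    qed
    ultimately have "proj_pt (A *v v) \<in> Sing g" using Sing_iff[OF hom] by blast
    with g show False by simp
  qed
  moreover have "h \<noteq> 0"
  proof
    assume "h = 0"
    then have "linear_pullback B h = 0" by (simp add: affine_pullback_def mp_eval_zero[OF ring_map_Const])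
    then show False using g by (simp add: A linear_pullback_compose B)
  qed
  ultimately show ?thesis using hom by (auto simp: smooth_form_def A homogeneous_linear_pullback)
qed

lemma curve_pt_eqD:
  assumes "curve_pt g = curve_pt h" "g \<noteq> 0"
  obtains c where "c \<noteq> 0" "g = Const c * h"
proof -
  have "g = Const 1 * g" by (simp add: Const_def)
  then have "g \<in> curve_pt h" using assms(1) by (metis curve_pt_def rangeI)
  then obtain c where c: "g = Const c * h" by (auto simp: curve_pt_def)
  moreover have "c \<noteq> 0" using c assms(2) by (auto simp: Const_def)
  ultimately show ?thesis using that by blast
qed

lemma linear_pullback_curve_pt: "linear_pullback A ` curve_pt g = curve_pt (linear_pullback A g)"
  by (simp add: curve_pt_def image_image linear_pullback_Const_mult)

lemma curve_orbit_lin_equiv: "curve_orbit (curve_pt g) = {curve_pt h | h. lin_equiv h g}"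
  unfolding curve_orbit_def linear_pullback_curve_pt lin_equiv_def by blast

lemma curve_orbit_eq_iff:
  assumes "g \<noteq> 0" "homogeneous d g" "homogeneous d h" "d \<noteq> 0"
  shows "curve_orbit (curve_pt g) = curve_orbit (curve_pt h) \<longleftrightarrow> lin_equiv g h"
proof
  assume "curve_orbit (curve_pt g) = curve_orbit (curve_pt h)"
  moreover have "curve_pt g \<in> curve_orbit (curve_pt g)"
    using lin_equiv_refl by (auto simp: curve_orbit_lin_equiv)
  ultimately obtain k where k: "curve_pt g = curve_pt k" "lin_equiv k h" by (auto simp: curve_orbit_lin_equiv)
  obtain c where c: "c \<noteq> 0" "g = Const c * k" using curve_pt_eqD[OF k(1) assms(1)] by blast
  have "homogeneous d k" using k(2) assms(3) by (auto simp: lin_equiv_def homogeneous_linear_pullback)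
  then show "lin_equiv g h" using lin_equiv_scale[OF _ assms(4) c(1)] c(2) k(2) lin_equiv_trans by metis
next
  assume "lin_equiv g h"
  then show "curve_orbit (curve_pt g) = curve_orbit (curve_pt h)"
    unfolding curve_orbit_lin_equiv using lin_equiv_sym lin_equiv_trans by blast
qed

text \<open>Intersections give products, unions the choice of a member, and for generators the
  homogeneity of \<open>F\<close> absorbs the change of representative. Open sets are thus turned
  into conditions on coefficients to which \<open>generic_plane\<close> applies.\<close>

lemma curve_zariski_neighbourhood:
  assumes "openin (curve_zariski d) W" "curve_pt g \<in> W" "g \<noteq> 0"
  shows "\<exists>p. polyfun p \<and> p (Poly_Mapping.lookup g) \<noteq> 0 \<and>
    (\<forall>h. h \<noteq> 0 \<longrightarrow> homogeneous d h \<longrightarrow> p (Poly_Mapping.lookup h) \<noteq> 0 \<longrightarrow> curve_pt h \<in> W)"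
  using assms(1)[unfolded curve_zariski_def openin_topology_generated_by_iff] assms(2)
proof (induction W rule: generate_topology_on.induct)
  case Empty
  then show ?case by simp
next
  case (Int U V)
  then have "curve_pt g \<in> U" "curve_pt g \<in> V" by simp_all
  from Int.IH(1)[OF this(1)] obtain p where p: "polyfun p" "p (Poly_Mapping.lookup g) \<noteq> 0"
      "\<forall>h. h \<noteq> 0 \<longrightarrow> homogeneous d h \<longrightarrow> p (Poly_Mapping.lookup h) \<noteq> 0 \<longrightarrow> curve_pt h \<in> U"
    by (elim exE conjE)
  from Int.IH(2)[OF \<open>curve_pt g \<in> V\<close>] obtain q where q: "polyfun q" "q (Poly_Mapping.lookup g) \<noteq> 0"
      "\<forall>h. h \<noteq> 0 \<longrightarrow> homogeneous d h \<longrightarrow> q (Poly_Mapping.lookup h) \<noteq> 0 \<longrightarrow> curve_pt h \<in> V"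
    by (elim exE conjE)
  from p q show ?case by (intro exI[of _ "\<lambda>x. p x * q x"]) (simp add: polyfun_mult)
next
  case (UN K)
  then obtain U where U: "U \<in> K" "curve_pt g \<in> U" by blast
  from UN.IH[OF U] obtain p where p: "polyfun p" "p (Poly_Mapping.lookup g) \<noteq> 0"
      "\<forall>h. h \<noteq> 0 \<longrightarrow> homogeneous d h \<longrightarrow> p (Poly_Mapping.lookup h) \<noteq> 0 \<longrightarrow> curve_pt h \<in> U"
    by (elim exE conjE)
  with U(1) show ?case by (intro exI[of _ p]) auto
next
  case (Basis S)
  then obtain F k where S: "S = {curve_pt g | g. g \<noteq> 0 \<and> homogeneous d g \<and> eval (Poly_Mapping.lookup g) F \<noteq> 0}"
    and F: "homogeneous k F" unfolding mem_Collect_eq by (elim exE conjE)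
  obtain h where h: "curve_pt g = curve_pt h" "eval (Poly_Mapping.lookup h) F \<noteq> 0"
    using Basis(2) by (auto simp: S)
  obtain c where c: "c \<noteq> 0" "g = Const c * h" using curve_pt_eqD[OF h(1) assms(3)] by blast
  have "Poly_Mapping.lookup g = (\<lambda>m. c * Poly_Mapping.lookup h m)" by (simp add: fun_eq_iff c lookup_Const_mult)
  then have "eval (Poly_Mapping.lookup g) F \<noteq> 0" using c(1) h(2) by (simp add: eval_scale_homogeneous[OF F])
  then show ?case by (intro exI[of _ "\<lambda>x. eval x F"]) (auto simp: S)
qed

text \<open>
  The scalar \<open>t\<close> makes the condition independent of the representative: it says that some
  homogeneous component of \<open>p\<close> does not vanish.
\<close>

lemma openin_curve_zariski:
  assumes "polyfun p"
  shows "openin (curve_zariski d) {curve_pt g | g. g \<noteq> 0 \<and> homogeneous d g \<and>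
    (\<exists>t. t \<noteq> 0 \<and> p (Poly_Mapping.lookup (Const t * g)) \<noteq> 0)}"
proof -
  obtain F where F: "\<And>x. p x = eval x F" using assms by (auto simp: polyfun_def)
  define K where "K = mdeg ` Poly_Mapping.keys F"
  define G where "G k = (\<Sum>m\<in>{m\<in>Poly_Mapping.keys F. mdeg m = k}. Poly_Mapping.single m (Poly_Mapping.lookup F m))" for k
  have G: "homogeneous k (G k)" for k
    unfolding G_def by (rule homogeneous_sum) (auto simp: homogeneous_def)
  have "(\<Sum>k\<in>K. G k) = F"
    unfolding G_def K_def by (subst sum.image_gen[symmetric]) (simp_all add: sum_singles)
  then have FG: "eval x F = (\<Sum>k\<in>K. eval x (G k))" for x by (metis eval_sum)
  have scale: "p (Poly_Mapping.lookup (Const t * g)) = (\<Sum>k\<in>K. t ^ k * eval (Poly_Mapping.lookup g) (G k))" for t g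
  proof -
    have "Poly_Mapping.lookup (Const t * g) = (\<lambda>m. t * Poly_Mapping.lookup g m)" by (simp add: fun_eq_iff lookup_Const_mult)
    then show ?thesis by (simp add: F FG eval_scale_homogeneous[OF G])
  qed
  have iff: "(\<exists>t. t \<noteq> 0 \<and> p (Poly_Mapping.lookup (Const t * g)) \<noteq> 0) \<longleftrightarrow> (\<exists>k\<in>K. eval (Poly_Mapping.lookup g) (G k) \<noteq> 0)" for g
  proof
    assume "\<exists>t. t \<noteq> 0 \<and> p (Poly_Mapping.lookup (Const t * g)) \<noteq> 0"
    then show "\<exists>k\<in>K. eval (Poly_Mapping.lookup g) (G k) \<noteq> 0"
      unfolding scale by (metis (no_types, lifting) mult_zero_right sum.neutral)
  next
    assume "\<exists>k\<in>K. eval (Poly_Mapping.lookup g) (G k) \<noteq> 0"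
    then obtain k where k: "k \<in> K" "eval (Poly_Mapping.lookup g) (G k) \<noteq> 0" by blast
    define r where "r = (\<Sum>k\<in>K. Polynomial.monom (eval (Poly_Mapping.lookup g) (G k)) k)"
    have "Polynomial.coeff r k = eval (Poly_Mapping.lookup g) (G k)"
      using k(1) by (simp add: r_def coeff_sum K_def)
    then have "r \<noteq> 0" using k(2) by auto
    \<comment> \<open>The factor \<open>[:0, 1:]\<close> makes 0 a root, so that the nonroot
      \<open>t\<close> is nonzero.\<close>
    then have "[:0, 1:] * r \<noteq> 0" by simp
    then obtain t where "poly ([:0, 1:] * r) t \<noteq> 0" using poly_all_0_iff_0 by blast
    then show "\<exists>t. t \<noteq> 0 \<and> p (Poly_Mapping.lookup (Const t * g)) \<noteq> 0"
      unfolding scale by (intro exI[of _ t]) (simp add: r_def poly_sum poly_monom mult.commute)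
  qed
  have "{curve_pt g | g. g \<noteq> 0 \<and> homogeneous d g \<and> (\<exists>t. t \<noteq> 0 \<and> p (Poly_Mapping.lookup (Const t * g)) \<noteq> 0)}
    = (\<Union>k\<in>K. {curve_pt g | g. g \<noteq> 0 \<and> homogeneous d g \<and> eval (Poly_Mapping.lookup g) (G k) \<noteq> 0})"
    unfolding iff by blast
  also have "openin (curve_zariski d) \<dots>"
    unfolding curve_zariski_def using G
    by (intro openin_Union ballI) (auto intro!: topology_generated_by_Basis)
  finally show ?thesis .
qed

subsection \<open>Generic finiteness of the section map\<close>

lemma plane_section_lin_equiv:
  assumes "H \<in> proj_space" "plane_param H M"
  shows "lin_equiv (plane_section f H) (linear_pullback M f)"
proof -
  obtain M' where M': "plane_param H M'" "plane_section f H = linear_pullback M' f"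
    using plane_section_param[OF assms(1)] by metis
  obtain A where "invertible A" "M' = M ** A" using plane_param_unique[OF assms(2) M'(1)] by metis
  then show ?thesis by (auto simp: lin_equiv_def M'(2) linear_pullback_compose)
qed

text \<open>If \<open>M\<close> parametrizes \<open>H\<close> and a coordinate change
  \<open>A\<close> takes its section to \<open>h\<close>, then \<open>M ** A\<close> lies in the
  fibre over \<open>h\<close> and has the same range as \<open>M\<close>. So every such plane is the
  range of a matrix in the fibre.\<close>

lemma finite_equivalent_sections:
  assumes fin: "finite {M :: complex^3^4. linear_pullback M f = h}"
  shows "finite {H \<in> proj_space. lin_equiv h (plane_section f H)}"
proof (rule finite_imageD)
  show "inj_on hyperplane_cone {H \<in> proj_space. lin_equiv h (plane_section f H)}"
    using hyperplane_cone_inj by (auto simp: inj_on_def)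
  have "hyperplane_cone H \<in> (\<lambda>M. range ((*v) M)) ` {M. linear_pullback M f = h}"
    if H: "H \<in> proj_space" "lin_equiv h (plane_section f H)" for H
  proof -
    obtain M where M: "plane_param H M" "plane_section f H = linear_pullback M f"
      using plane_section_param[OF H(1)] by metis
    obtain A where A: "invertible A" "h = linear_pullback A (plane_section f H)"
      using H(2) by (auto simp: lin_equiv_def)
    obtain B where B: "A ** B = mat 1" using A(1) by (auto simp: invertible_def)
    have "range ((*v) (M ** A)) = range ((*v) M)"
    proof (intro equalityI image_subsetI)
      fix y show "(M ** A) *v y \<in> range ((*v) M)" by (simp flip: matrix_vector_mul_assoc)
      have "M *v y = (M ** A) *v (B *v y)"
        by (metis B matrix_mul_assoc matrix_mul_rid matrix_vector_mul_assoc)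
      then show "M *v y \<in> range ((*v) (M ** A))" by blast
    qed
    then have "hyperplane_cone H = range ((*v) (M ** A))" using M(1) by (simp add: plane_param_def)
    moreover have "linear_pullback (M ** A) f = h" by (simp add: A M(2) linear_pullback_compose)
    ultimately show ?thesis by blast
  qed
  then have "hyperplane_cone ` {H \<in> proj_space. lin_equiv h (plane_section f H)}
      \<subseteq> (\<lambda>M. range ((*v) M)) ` {M. linear_pullback M f = h}" by blast
  then show "finite (hyperplane_cone ` {H \<in> proj_space. lin_equiv h (plane_section f H)})"
    using fin finite_subset by blast
qed

theorem corollary6p5:
  fixes f :: "4 mpoly" and d :: nat
  assumes "d \<ge> 4"
    and "f \<noteq> 0" and "homogeneous d f"
    and "finite (Sing f)"
    and "tjurina f < enat ((d - 2) * (d - 1)^2)"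
    and "\<exists>H'\<in>proj_space. hyperplane H' \<inter> Sing f = {} \<and>
           three_noncollinear_nodes (plane_section f H')"
  shows "generically_finite_onto_image (moduli_space d) (section_domain d f)
           (hyperplane_section_map f)"
proof -
  note hom = assms(3)
  have d: "d \<noteq> 0" "d \<ge> 2" using assms(1) by auto
  obtain H' where H': "H' \<in> proj_space" "hyperplane H' \<inter> Sing f = {}"
    and nodes: "three_noncollinear_nodes (plane_section f H')" using assms(6) by blast
  obtain M0 where M0: "plane_param H' M0" "plane_section f H' = linear_pullback M0 f"
    using plane_section_param[OF H'(1)] by metis
  have inj: "N = 0" if "\<And>y. dir_deriv f (M0 *v y) (N *v y) = 0" for N :: "complex^3^4"
    by (rule differential_injective[OF assms(1) hom H'(1) M0(1) H'(2)])
       (use nodes that in \<open>auto simp: three_noncollinear_nodes_def M0(2)\<close>)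
  have "\<exists>(y :: 4 \<times> 3 \<Rightarrow> complex^3) C. polyfun C \<and>
      (\<exists>M :: complex^3^4. C (samples y (linear_pullback M f)) \<noteq> 0) \<and>
      (\<forall>g. C (samples y g) \<noteq> 0 \<longrightarrow> finite {M :: complex^3^4. linear_pullback M f = g})"
    by (rule generic_finiteness[of f M0], rule inj, simp)
  then obtain y :: "4 \<times> 3 \<Rightarrow> complex^3" and C and M2 :: "complex^3^4"
    where C: "polyfun C" and M2: "C (samples y (linear_pullback M2 f)) \<noteq> 0"
    and finC: "\<forall>g. C (samples y g) \<noteq> 0 \<longrightarrow> finite {M :: complex^3^4. linear_pullback M f = g}"
    by (elim exE conjE)
  \<comment> \<open>The test \<open>C\<close> depends on coordinates; a form is good if it passes
    after some change of coordinates.\<close>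
  define good where "good g \<longleftrightarrow> (\<exists>h. lin_equiv h g \<and> C (samples y h) \<noteq> 0)" for g
  have good_equiv: "good h" if "lin_equiv h g" "good g" for h g
    using that lin_equiv_sym lin_equiv_trans unfolding good_def by blast
  define Z where "Z = curve_zariski d"
  let ?U = "section_domain d f" and ?\<phi> = "hyperplane_section_map f" and ?Y = "moduli_space d"
  have smoothD: "g \<noteq> 0" "homogeneous d g" if "smooth_form d g" for g
    using that by (simp_all add: smooth_form_def)
  have Ztop: "smooth_curves d \<subseteq> topspace Z"
    using openin_subset[OF openin_curve_zariski[OF polyfun_const[of 1], of d]]
    by (fastforce simp: smooth_curves_def Z_def smooth_form_def intro: exI[of _ 1])
  have Ytop: "topspace ?Y = curve_orbit ` smooth_curves d"
    using Ztop by (simp add: moduli_space_def topspace_quotient_topology Z_def Int_absorb1)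
  have orbit_iff: "curve_orbit (curve_pt g) = curve_orbit (curve_pt h) \<longleftrightarrow> lin_equiv g h"
    if "smooth_form d g" "smooth_form d h" for g h
    using curve_orbit_eq_iff[OF smoothD(1,2)[OF that(1)] smoothD(2)[OF that(2)] d(1)] .
  have U_smooth: "smooth_form d (plane_section f H)" and U_proj: "H \<in> proj_space" if "H \<in> ?U" for H
    using that by (simp_all add: section_domain_def)
  have \<phi>: "?\<phi> H = curve_orbit (curve_pt (plane_section f H))" for H
    by (simp add: hyperplane_section_map_def)
  have image: "?\<phi> ` ?U \<subseteq> topspace ?Y"
    using U_smooth by (auto simp: Ytop \<phi> smooth_curves_def)

  \<comment> \<open>The test after the change \<open>A\<close>, as a polynomial in the coefficients
    of a form. The box is a finite set that contains all monomials of degree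
    \<open>d\<close>.\<close>
  define p where "p A x = C (\<lambda>k. \<Sum>m\<in>monom_box (Suc d). x m * mon (($) (A *v y k)) m)"
    for A and x :: "3 monom \<Rightarrow> complex"
  have p_poly: "polyfun (p A)" for A unfolding p_def[abs_def]
    by (intro polyfun_compose[OF C] polyfun_sum polyfun_mult polyfun_var polyfun_const)
  have p_eval: "p A (Poly_Mapping.lookup g) = C (samples y (linear_pullback A g))" if "homogeneous d g" for A g
  proof -
    have "Poly_Mapping.keys g \<subseteq> monom_box (Suc d)"
    proof
      fix m assume "m \<in> Poly_Mapping.keys g"
      then have "mdeg m = d" using that by (simp add: homogeneous_def)
      then show "m \<in> monom_box (Suc d)" using lookup_le_mdeg[of m] by (simp add: monom_box_def less_Suc_eq_le)
    qed
    then have "eval x g = (\<Sum>m\<in>monom_box (Suc d). Poly_Mapping.lookup g m * mon x m)" for x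
      by (intro mp_eval_superset) (simp_all add: monom_box_card)
    then show ?thesis unfolding p_def samples_def eval_linear_pullback by simp
  qed
  define S where "S A = {curve_pt g | g. g \<noteq> 0 \<and> homogeneous d g \<and>
    (\<exists>t. t \<noteq> 0 \<and> p A (Poly_Mapping.lookup (Const t * g)) \<noteq> 0)}" for A
  define G where "G = (\<Union>A\<in>Collect invertible. S A)"
  have G_open: "openin Z G"
    unfolding G_def S_def Z_def by (intro openin_Union) (auto intro: openin_curve_zariski[OF p_poly])
  have hom_Const: "homogeneous d (Const t * g)" if "homogeneous d g" for t and g :: "3 mpoly"
    using homogeneous_mult[OF homogeneous_Const that] by simp
  have G_iff: "curve_pt g \<in> G \<longleftrightarrow> good g" if g: "smooth_form d g" for g
  proof
    assume "curve_pt g \<in> G"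
    then obtain A h t where h: "invertible A" "curve_pt g = curve_pt h" "homogeneous d h" "t \<noteq> 0"
      "p A (Poly_Mapping.lookup (Const t * h)) \<noteq> 0" by (auto simp: G_def S_def)
    obtain c where c: "c \<noteq> 0" "g = Const c * h" using curve_pt_eqD[OF h(2) smoothD(1)[OF g]] by blast
    have "C (samples y (linear_pullback A (Const t * h))) \<noteq> 0"
      using h(5) p_eval[OF hom_Const[OF h(3)]] by simp
    then have "good (Const t * h)" using h(1) unfolding good_def lin_equiv_def by blast
    moreover have "lin_equiv g (Const t * h)"
      using lin_equiv_scale[OF h(3) d(1) c(1)] lin_equiv_scale[OF h(3) d(1) h(4)]
      unfolding c(2) by (metis lin_equiv_sym lin_equiv_trans)
    ultimately show "good g" using good_equiv by blast
  next
    assume "good g"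
    then obtain A where A: "invertible A" "C (samples y (linear_pullback A g)) \<noteq> 0"
      by (auto simp: good_def lin_equiv_def)
    have "Const 1 * g = g" by (simp add: Const_def)
    then have "curve_pt g \<in> S A" unfolding S_def
      using A(2) p_eval[OF smoothD(2)[OF g]] smoothD[OF g] by (metis (mono_tags, lifting) mem_Collect_eq zero_neq_one)
    then show "curve_pt g \<in> G" using A(1) by (auto simp: G_def)
  qed
  define O' where "O' = curve_orbit ` {curve_pt g | g. smooth_form d g \<and> good g}"
  have O'_iff: "curve_orbit (curve_pt g) \<in> O' \<longleftrightarrow> good g" if g: "smooth_form d g" for g
  proof
    assume "curve_orbit (curve_pt g) \<in> O'"
    then obtain h where "smooth_form d h" "good h" "curve_orbit (curve_pt g) = curve_orbit (curve_pt h)"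
      by (auto simp: O'_def)
    then show "good g" using orbit_iff[OF g] good_equiv by blast
  qed (use g in \<open>auto simp: O'_def\<close>)
  \<comment> \<open>Goodness is constant on orbits, so the preimage of \<open>O'\<close> is cut out
    by \<open>G\<close>; this is openness in the quotient topology.\<close>
  have "{x \<in> smooth_curves d. curve_orbit x \<in> O'} = G \<inter> smooth_curves d"
    using O'_iff G_iff by (auto simp: smooth_curves_def)
  moreover have "O' \<subseteq> curve_orbit ` smooth_curves d" by (auto simp: O'_def smooth_curves_def)
  ultimately have O'_open: "openin ?Y O'"
    using Ztop G_open unfolding moduli_space_def openin_quotient_topology Z_def[symmetric]
    by (auto simp: Int_absorb1 openin_subtopology)
  define V where "V = ?\<phi> ` ?U \<inter> O'"

  \<comment> \<open>\<open>T\<close> pulls back to an open set of curves, and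
    \<open>generic_plane\<close> finds a plane with section in it that also passes the test. The
    matrix found need not be the one chosen by \<open>plane_section\<close>, hence the passage
    through \<open>lin_equiv\<close>.\<close>
  have dense: "\<exists>H\<in>?U. ?\<phi> H \<in> V \<inter> T" if T: "openin ?Y T" and H0: "H0 \<in> ?U" "?\<phi> H0 \<in> T" for T H0
  proof -
    have "openin (subtopology Z (smooth_curves d)) {x \<in> smooth_curves d. curve_orbit x \<in> T}"
      using T Ztop unfolding moduli_space_def openin_quotient_topology Z_def[symmetric]
      by (simp add: Int_absorb1)
    then obtain W where W: "openin Z W" "{x \<in> smooth_curves d. curve_orbit x \<in> T} = W \<inter> smooth_curves d"
      by (auto simp: openin_subtopology)
    obtain M1 where M1: "plane_section f H0 = linear_pullback M1 f"
      using plane_section_param[OF U_proj[OF H0(1)]] by metis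
    have "curve_pt (plane_section f H0) \<in> W"
      using W(2) H0 U_smooth[OF H0(1)] by (auto simp: smooth_curves_def \<phi>)
    from curve_zariski_neighbourhood[OF W(1)[unfolded Z_def] this smoothD(1)[OF U_smooth[OF H0(1)]]]
    obtain q where q: "polyfun q" "q (Poly_Mapping.lookup (linear_pullback M1 f)) \<noteq> 0"
      "\<forall>h. h \<noteq> 0 \<longrightarrow> homogeneous d h \<longrightarrow> q (Poly_Mapping.lookup h) \<noteq> 0 \<longrightarrow> curve_pt h \<in> W"
      unfolding M1 by (elim exE conjE)
    obtain H M where H: "H \<in> ?U" "plane_param H M" "C (samples y (linear_pullback M f)) \<noteq> 0"
      "q (Poly_Mapping.lookup (linear_pullback M f)) \<noteq> 0"
      using generic_plane[OF d(2) assms(2) hom assms(4) C M2 q(1,2)] by metis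
    let ?g = "linear_pullback M f"
    have eq: "lin_equiv (plane_section f H) ?g" using plane_section_lin_equiv[OF U_proj[OF H(1)] H(2)] .
    have g: "smooth_form d ?g" using lin_equiv_smooth[OF lin_equiv_sym[OF eq] U_smooth[OF H(1)]] .
    have \<phi>H: "?\<phi> H = curve_orbit (curve_pt ?g)" using eq orbit_iff[OF U_smooth[OF H(1)] g] by (simp add: \<phi>)
    have "curve_pt ?g \<in> W \<inter> smooth_curves d" using q(3) H(4) g smoothD[OF g] by (auto simp: smooth_curves_def)
    then have "?\<phi> H \<in> T" using W(2) by (auto simp: \<phi>H)
    moreover have "good ?g" using H(3) lin_equiv_refl by (auto simp: good_def)
    then have "?\<phi> H \<in> O'" using O'_iff[OF g] by (simp add: \<phi>H)
    ultimately show ?thesis using H(1) by (auto simp: V_def)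
  qed

  have nonempty: "V \<noteq> {}"
  proof -
    \<comment> \<open>Any plane in the domain will do, so the condition on coefficients is the
      constant 1.\<close>
    obtain H M where "H \<in> ?U" by (rule generic_plane[OF d(2) assms(2) hom assms(4) C M2 polyfun_const[of 1]]) simp_all
    moreover have "openin ?Y (topspace ?Y)" by simp
    ultimately show ?thesis using dense image by blast
  qed
  have Xtop: "topspace (subtopology ?Y (?\<phi> ` ?U)) = ?\<phi> ` ?U" using image by auto
  have closure: "(subtopology ?Y (?\<phi> ` ?U)) closure_of V = ?\<phi> ` ?U"
  proof
    show "(subtopology ?Y (?\<phi> ` ?U)) closure_of V \<subseteq> ?\<phi> ` ?U"
      using closure_of_subset_topspace[of "subtopology ?Y (?\<phi> ` ?U)" V] Xtop by simp
    show "?\<phi> ` ?U \<subseteq> (subtopology ?Y (?\<phi> ` ?U)) closure_of V"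
    proof (rule image_subsetI)
      fix H0 assume H0: "H0 \<in> ?U"
      have "\<exists>z\<in>V. z \<in> T" if T: "?\<phi> H0 \<in> T" "openin (subtopology ?Y (?\<phi> ` ?U)) T" for T
      proof -
        obtain T' where T': "openin ?Y T'" "T = T' \<inter> ?\<phi> ` ?U" using T(2) by (auto simp: openin_subtopology)
        then obtain H where "H \<in> ?U" "?\<phi> H \<in> V \<inter> T'" using dense[OF T'(1) H0] T(1) by blast
        with T'(2) show ?thesis by blast
      qed
      then show "?\<phi> H0 \<in> (subtopology ?Y (?\<phi> ` ?U)) closure_of V"
        unfolding in_closure_of Xtop using H0 by auto
    qed
  qed
  have finite_fibre: "finite {H \<in> ?U. ?\<phi> H = z}" if z: "z \<in> V" for z
  proof -
    obtain H0 where H0: "H0 \<in> ?U" "z = ?\<phi> H0" "?\<phi> H0 \<in> O'" using z by (auto simp: V_def)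
    then have "good (plane_section f H0)" using O'_iff[OF U_smooth[OF H0(1)]] by (simp add: \<phi>)
    \<comment> \<open>The test is passed by some form \<open>h\<close> in the orbit, perhaps not by
      the section itself; all sections in the fibre are equivalent to \<open>h\<close>.\<close>
    then obtain h where h: "lin_equiv h (plane_section f H0)" "C (samples y h) \<noteq> 0" by (auto simp: good_def)
    have "lin_equiv h (plane_section f H)" if "H \<in> ?U" "?\<phi> H = z" for H
    proof -
      have "lin_equiv (plane_section f H0) (plane_section f H)"
        using orbit_iff[OF U_smooth[OF H0(1)] U_smooth[OF that(1)]] that(2) H0(2) by (simp add: \<phi>)
      with h(1) show ?thesis using lin_equiv_trans by blast
    qed
    then have "{H \<in> ?U. ?\<phi> H = z} \<subseteq> {H \<in> proj_space. lin_equiv h (plane_section f H)}" using U_proj by blast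
    then show ?thesis using finite_equivalent_sections[OF finC[rule_format, OF h(2)]] finite_subset by blast
  qed
  have "openin (subtopology ?Y (?\<phi> ` ?U)) V"
    using O'_open unfolding V_def openin_subtopology by blast
  with image nonempty closure finite_fibre show ?thesis
    unfolding generically_finite_onto_image_def by blast
qed

end
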